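(* The class $\mathsf{CT}^{\mathit{rest},\mathit{bf}}_{\forall}$ of all knowledge bases that only admit finite breadth-first chase sequences is recursively enumerable, and the class of all finite rule sets $\Sigma$ such that $\langle\Sigma,D\rangle\in\mathsf{CT}^{\mathit{rest},\mathit{bf}}_{\forall}$ for every database $D$ is in $\Pi^0_2$.
   Context: Existential rules: closed formulas $\forall \vec x,\vec y.\, B[\vec x,\vec y]\to\exists \vec z.\, H[\vec y,\vec z]$ with $B,H$ null-free conjunctions of atoms, $H$ non-empty. A database is a finite set of null-free facts; a knowledge base is a pair $\langle\Sigma,D\rangle$ of a finite rule set and a database. A trigger $\langle R,\sigma\rangle$ consists of a rule $R$ and a substitution $\sigma$ defined exactly on the universally quantified variables of $R$ ($\Sigma$-trigger if $R\in\Sigma$); loaded for fact set $F$ if $\sigma(\mathrm{body}(R))\subseteq F$; obsolete for $F$ if some extension $\sigma'$ of $\sigma$ to the existential variables satisfies $\sigma'(\mathrm{head}(R))\subseteq F$; its output is $\sigma'(\mathrm{head}(R))$ with $\sigma'$ mapping existential variables to fresh nulls. A (restricted) chase derivation for $\langle\Sigma,D\rangle$ is a possibly infinite sequence $F_0=D,F_1,\dots$ with $F_{i+1}=F_i\cup\mathrm{output}(\lambda)$ for some $\Sigma$-trigger $\lambda$ loaded and not obsolete for $F_i$. A breadth-first chase sequence for $\langle\Sigma,D\rangle$ is a chase derivation $F_0,F_1,\dots$ such that, whenever some $\Sigma$-trigger $\lambda$ is loaded for some $F_i$, there is some $j\in\{i,\dots,i+n\}$ such that $\lambda$ is obsolete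 for $F_j$, where $n$ is the (finite) number of $\Sigma$-triggers that are loaded and not obsolete for $F_i$. *)

theory Defs
  imports Main "HOL-Library.Nat_Bijection" "HOL-Library.Extended_Nat"
begin

section \<open>Existential rules and the restricted chase\<close>

datatype trm = Var nat | Const nat | Null nat

text \<open>A predicate symbol of arity \<open>n\<close> is given by a name and \<open>n\<close>; since \<open>n\<close> is the length of the
  argument list, atoms with equal names but different numbers of arguments are built from
  different predicates.\<close>

datatype atom = Atom (pname: nat) (args: "trm list")

fun var_free :: "trm \<Rightarrow> bool" where
  "var_free (Var _) = False"
| "var_free _ = True"

fun null_free :: "trm \<Rightarrow> bool" where
  "null_free (Null _) = False"
| "null_free _ = True"

definition vars_atoms :: "atom set \<Rightarrow> nat set" where
  "vars_atoms A = {v. \<exists>a\<in>A. Var v \<in> set (args a)}"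

definition nulls_atoms :: "atom set \<Rightarrow> nat set" where
  "nulls_atoms A = {n. \<exists>a\<in>A. Null n \<in> set (args a)}"

definition null_free_atom :: "atom \<Rightarrow> bool" where
  "null_free_atom a \<longleftrightarrow> (\<forall>t\<in>set (args a). null_free t)"

definition is_fact :: "atom \<Rightarrow> bool" where
  "is_fact a \<longleftrightarrow> (\<forall>t\<in>set (args a). var_free t)"

definition database :: "atom set \<Rightarrow> bool" where
  "database D \<longleftrightarrow> finite D \<and> (\<forall>a\<in>D. is_fact a \<and> null_free_atom a)"

text \<open>In \<open>\<forall>x y. B[x,y] \<longrightarrow> (\<exists>z. H[y,z])\<close> the tuples \<open>x\<close>, \<open>y\<close> consist of exactly the variables of \<open>B\<close>
  and \<open>z\<close> of the variables that occur in \<open>H\<close> only, so \<open>B\<close> and \<open>H\<close> determine the quantifier prefix.\<close>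

datatype ex_rule = Rule (body: "atom list") (head: "atom list")

definition univ_vars :: "ex_rule \<Rightarrow> nat set" where
  "univ_vars R = vars_atoms (set (body R))"

definition exis_vars :: "ex_rule \<Rightarrow> nat set" where
  "exis_vars R = vars_atoms (set (head R)) - univ_vars R"

definition existential_rule :: "ex_rule \<Rightarrow> bool" where
  "existential_rule R \<longleftrightarrow>
     (\<forall>a\<in>set (body R) \<union> set (head R). null_free_atom a) \<and> head R \<noteq> []"

definition rule_set :: "ex_rule set \<Rightarrow> bool" where
  "rule_set \<Sigma> \<longleftrightarrow> finite \<Sigma> \<and> (\<forall>R\<in>\<Sigma>. existential_rule R)"

type_synonym kb = "ex_rule set \<times> atom set"

definition knowledge_base :: "kb \<Rightarrow> bool" where
  "knowledge_base K \<longleftrightarrow> rule_set (fst K) \<and> database (snd K)"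

type_synonym substitution = "nat \<rightharpoonup> trm"

definition substitution_on :: "nat set \<Rightarrow> substitution \<Rightarrow> bool" where
  "substitution_on V \<sigma> \<longleftrightarrow> dom \<sigma> = V \<and> (\<forall>t\<in>ran \<sigma>. var_free t)"

fun apply_trm :: "substitution \<Rightarrow> trm \<Rightarrow> trm" where
  "apply_trm \<sigma> (Var v) = (case \<sigma> v of Some t \<Rightarrow> t | None \<Rightarrow> Var v)"
| "apply_trm \<sigma> t = t"

definition apply_atom :: "substitution \<Rightarrow> atom \<Rightarrow> atom" where
  "apply_atom \<sigma> a = Atom (pname a) (map (apply_trm \<sigma>) (args a))"

type_synonym trigger = "ex_rule \<times> substitution"

definition triggers :: "ex_rule set \<Rightarrow> trigger set" where
  "triggers \<Sigma> = {(R, \<sigma>). R \<in> \<Sigma> \<and> substitution_on (univ_vars R) \<sigma>}"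

definition loaded :: "trigger \<Rightarrow> atom set \<Rightarrow> bool" where
  "loaded \<tau> F \<longleftrightarrow> (case \<tau> of (R, \<sigma>) \<Rightarrow> apply_atom \<sigma> ` set (body R) \<subseteq> F)"

definition extension_to_exis :: "trigger \<Rightarrow> substitution \<Rightarrow> bool" where
  "extension_to_exis \<tau> \<sigma>' \<longleftrightarrow> (case \<tau> of (R, \<sigma>) \<Rightarrow>
     substitution_on (univ_vars R \<union> exis_vars R) \<sigma>' \<and> \<sigma> \<subseteq>\<^sub>m \<sigma>')"

definition obsolete :: "trigger \<Rightarrow> atom set \<Rightarrow> bool" where
  "obsolete \<tau> F \<longleftrightarrow>
     (\<exists>\<sigma>'. extension_to_exis \<tau> \<sigma>' \<and> apply_atom \<sigma>' ` set (head (fst \<tau>)) \<subseteq> F)"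

text \<open>Freshness is relative to the fact set to which the trigger is applied: distinct existential
  variables are sent to distinct nulls that do not occur in \<open>F\<close>.\<close>

definition is_output :: "trigger \<Rightarrow> atom set \<Rightarrow> atom set \<Rightarrow> bool" where
  "is_output \<tau> F Out \<longleftrightarrow>
     (\<exists>\<sigma>' \<nu>. extension_to_exis \<tau> \<sigma>' \<and>
        inj_on \<nu> (exis_vars (fst \<tau>)) \<and>
        (\<forall>z\<in>exis_vars (fst \<tau>). \<sigma>' z = Some (Null (\<nu> z)) \<and> \<nu> z \<notin> nulls_atoms F) \<and>
        Out = apply_atom \<sigma>' ` set (head (fst \<tau>)))"

definition active_triggers :: "ex_rule set \<Rightarrow> atom set \<Rightarrow> trigger set" where
  "active_triggers \<Sigma> F = {\<tau>\<in>triggers \<Sigma>. loaded \<tau> F \<and> \<not> obsolete \<tau> F}"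

definition chase_step :: "ex_rule set \<Rightarrow> atom set \<Rightarrow> atom set \<Rightarrow> bool" where
  "chase_step \<Sigma> F F' \<longleftrightarrow>
     (\<exists>\<tau>\<in>active_triggers \<Sigma> F. \<exists>Out. is_output \<tau> F Out \<and> F' = F \<union> Out)"

text \<open>A possibly infinite sequence is a function \<open>F\<close> together with the index \<open>L\<close> of its last
  element, where \<open>L = \<infinity>\<close> for infinite sequences; values of \<open>F\<close> beyond \<open>L\<close> are irrelevant.\<close>

definition chase_derivation :: "kb \<Rightarrow> (nat \<Rightarrow> atom set) \<Rightarrow> enat \<Rightarrow> bool" where
  "chase_derivation K F L \<longleftrightarrow>
     F 0 = snd K \<and> (\<forall>i. enat i < L \<longrightarrow> chase_step (fst K) (F i) (F (Suc i)))"

definition breadth_first :: "kb \<Rightarrow> (nat \<Rightarrow> atom set) \<Rightarrow> enat \<Rightarrow> bool" where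
  "breadth_first K F L \<longleftrightarrow>
     chase_derivation K F L \<and>
     (\<forall>i. enat i \<le> L \<longrightarrow> (\<forall>\<tau>\<in>triggers (fst K). loaded \<tau> (F i) \<longrightarrow>
        (\<exists>j\<in>{i..i + card (active_triggers (fst K) (F i))}. enat j \<le> L \<and> obsolete \<tau> (F j))))"

definition CT_rest_bf :: "kb set" where
  "CT_rest_bf = {K. knowledge_base K \<and> (\<forall>F L. breadth_first K F L \<longrightarrow> L \<noteq> \<infinity>)}"

definition CT_rest_bf_rules :: "ex_rule set set" where
  "CT_rest_bf_rules = {\<Sigma>. rule_set \<Sigma> \<and> (\<forall>D. database D \<longrightarrow> (\<Sigma>, D) \<in> CT_rest_bf)}"

text \<open>The cardinality in \<open>breadth_first\<close> is that of a finite set.\<close>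

lemma finite_active_triggers:
  assumes "finite \<Sigma>" "finite F"
  shows "finite (active_triggers \<Sigma> F)"
proof -
  define T where "T = (\<Union>a\<in>F. set (args a))"
  have finT: "finite T" using assms(2) by (simp add: T_def)
  have finV: "finite (univ_vars R)" for R
  proof -
    have "univ_vars R \<subseteq> (\<Union>a\<in>set (body R). (\<lambda>t. case t of Var v \<Rightarrow> v | _ \<Rightarrow> 0) ` set (args a))"
      unfolding univ_vars_def vars_atoms_def by (force simp: image_iff split: trm.splits)
    then show ?thesis by (rule finite_subset) simp
  qed
  have "active_triggers \<Sigma> F \<subseteq> (\<Union>R\<in>\<Sigma>. Pair R ` {\<sigma>. dom \<sigma> = univ_vars R \<and> ran \<sigma> \<subseteq> T})"
  proof
    fix l assume "l \<in> active_triggers \<Sigma> F"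
    then obtain R \<sigma> where l: "l = (R, \<sigma>)" "R \<in> \<Sigma>" "dom \<sigma> = univ_vars R"
      "apply_atom \<sigma> ` set (body R) \<subseteq> F"
      unfolding active_triggers_def triggers_def loaded_def substitution_on_def by auto
    have "t \<in> T" if "\<sigma> v = Some t" for v t
    proof -
      have "v \<in> univ_vars R" using that l(3) by blast
      then obtain a where a: "a \<in> set (body R)" "Var v \<in> set (args a)"
        unfolding univ_vars_def vars_atoms_def by blast
      have "apply_trm \<sigma> (Var v) \<in> set (args (apply_atom \<sigma> a))"
        using a(2) unfolding apply_atom_def by (simp del: apply_trm.simps)
      then have "t \<in> set (args (apply_atom \<sigma> a))" using that by simp
      moreover have "apply_atom \<sigma> a \<in> F" using a(1) l(4) by blast
      ultimately show ?thesis unfolding T_def by blast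
    qed
    then have "ran \<sigma> \<subseteq> T" unfolding ran_def by blast
    then show "l \<in> (\<Union>R\<in>\<Sigma>. Pair R ` {\<sigma>. dom \<sigma> = univ_vars R \<and> ran \<sigma> \<subseteq> T})"
      using l by blast
  qed
  moreover have "finite \<dots>"
    using assms(1) finV finT by (auto intro!: finite_set_of_finite_maps)
  ultimately show ?thesis by (rule finite_subset)
qed

section \<open>Recursive functions and the arithmetical hierarchy\<close>

datatype recf =
    Zero
  | Succ
  | Proj nat
  | Comp recf "recf list"
  | PrimRec recf recf
  | Mu recf

text \<open>\<open>rec_eval f xs y\<close>: the partial recursive function denoted by \<open>f\<close> is defined on \<open>xs\<close> with
  value \<open>y\<close>. Recursion and minimisation act on the first argument.\<close>

inductive rec_eval :: "recf \<Rightarrow> nat list \<Rightarrow> nat \<Rightarrow> bool" where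
  eval_Zero: "rec_eval Zero xs 0"
| eval_Succ: "rec_eval Succ [x] (Suc x)"
| eval_Proj: "i < length xs \<Longrightarrow> rec_eval (Proj i) xs (xs ! i)"
| eval_Comp: "length ys = length gs \<Longrightarrow> (\<forall>i<length gs. rec_eval (gs ! i) xs (ys ! i)) \<Longrightarrow>
    rec_eval f ys z \<Longrightarrow> rec_eval (Comp f gs) xs z"
| eval_PrimRec_0: "rec_eval f xs y \<Longrightarrow> rec_eval (PrimRec f g) (0 # xs) y"
| eval_PrimRec_Suc: "rec_eval (PrimRec f g) (n # xs) y \<Longrightarrow> rec_eval g (n # y # xs) z \<Longrightarrow>
    rec_eval (PrimRec f g) (Suc n # xs) z"
| eval_Mu: "rec_eval f (n # xs) 0 \<Longrightarrow> (\<forall>m<n. \<exists>y. rec_eval f (m # xs) (Suc y)) \<Longrightarrow>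
    rec_eval (Mu f) xs n"

lemma rec_eval_deterministic:
  "rec_eval f xs y \<Longrightarrow> rec_eval f xs z \<Longrightarrow> y = z"
proof (induction arbitrary: z rule: rec_eval.induct)
  case (eval_Comp ys gs xs f y)
  from eval_Comp.prems obtain ys' where ys': "length ys' = length gs"
    "\<forall>i<length gs. rec_eval (gs ! i) xs (ys' ! i)" "rec_eval f ys' z"
    by (cases rule: rec_eval.cases) auto
  have "ys = ys'"
    using eval_Comp.IH(1) eval_Comp.hyps(1) ys'(1,2) by (intro nth_equalityI) auto
  then show ?case using eval_Comp.IH ys'(3) by blast
next
  case (eval_PrimRec_Suc f g n xs y z')
  from eval_PrimRec_Suc.prems obtain y' where "rec_eval (PrimRec f g) (n # xs) y'"
    "rec_eval g (n # y' # xs) z"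
    by (cases rule: rec_eval.cases) auto
  then show ?case using eval_PrimRec_Suc.IH by blast
next
  case (eval_Mu f n xs)
  from eval_Mu.prems have z: "rec_eval f (z # xs) 0"
    "\<forall>m<z. \<exists>y. rec_eval f (m # xs) (Suc y)"
    by (cases rule: rec_eval.cases; auto)+
  show ?case
  proof (rule linorder_cases[of n z])
    assume "n < z"
    then show ?thesis using z(2) eval_Mu.IH(1) by blast
  next
    assume "z < n"
    then show ?thesis using z(1) eval_Mu.IH(2) by blast
  qed
qed (erule rec_eval.cases; simp)+

definition recursively_enumerable :: "nat set \<Rightarrow> bool" where
  "recursively_enumerable A \<longleftrightarrow> (\<exists>f. A = {x. \<exists>y. rec_eval f [x] y})"

definition recursive_relation :: "nat \<Rightarrow> (nat list \<Rightarrow> bool) \<Rightarrow> bool" where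
  "recursive_relation k P \<longleftrightarrow>
     (\<exists>f. \<forall>xs. length xs = k \<longrightarrow> rec_eval f xs (if P xs then 1 else 0))"

definition in_Pi02 :: "nat set \<Rightarrow> bool" where
  "in_Pi02 A \<longleftrightarrow> (\<exists>P. recursive_relation 3 P \<and> A = {x. \<forall>y. \<exists>z. P [x, y, z]})"

section \<open>Codes of knowledge bases and rule sets\<close>

fun trm_code :: "trm \<Rightarrow> nat" where
  "trm_code (Var n) = 3 * n"
| "trm_code (Const n) = 3 * n + 1"
| "trm_code (Null n) = 3 * n + 2"

definition atom_code :: "atom \<Rightarrow> nat" where
  "atom_code a = prod_encode (pname a, list_encode (map trm_code (args a)))"

definition atoms_code :: "atom list \<Rightarrow> nat" where
  "atoms_code as = list_encode (map atom_code as)"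

definition rule_code :: "ex_rule \<Rightarrow> nat" where
  "rule_code R = prod_encode (atoms_code (body R), atoms_code (head R))"

definition rules_code :: "ex_rule list \<Rightarrow> nat" where
  "rules_code Rs = list_encode (map rule_code Rs)"

definition kb_code :: "ex_rule list \<Rightarrow> atom list \<Rightarrow> nat" where
  "kb_code Rs as = prod_encode (rules_code Rs, atoms_code as)"

text \<open>Finite sets are presented by lists of their elements; the codes of a class of finite objects
  are the codes of all presentations of its members.\<close>

definition kb_codes :: "kb set \<Rightarrow> nat set" where
  "kb_codes \<K> = {kb_code Rs as | Rs as. (set Rs, set as) \<in> \<K>}"

definition rules_codes :: "ex_rule set set \<Rightarrow> nat set" where
  "rules_codes \<R> = {rules_code Rs | Rs. set Rs \<in> \<R>}"

lemma trm_code_inj: "inj trm_code"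
proof (rule injI)
  fix s t assume "trm_code s = trm_code t"
  then show "s = t" by (cases s; cases t; simp; presburger)
qed

lemma atom_code_inj: "inj atom_code"
  using inj_mapI[OF trm_code_inj]
  by (auto simp: inj_def list_encode_eq atom_code_def atom.expand)

lemma atoms_code_eq: "atoms_code as = atoms_code bs \<longleftrightarrow> as = bs"
  using inj_mapI[OF atom_code_inj] by (auto simp: inj_def list_encode_eq atoms_code_def)

lemma rule_code_inj: "inj rule_code"
  by (auto simp: inj_def rule_code_def atoms_code_eq ex_rule.expand)

lemma rules_code_eq: "rules_code Rs = rules_code Ss \<longleftrightarrow> Rs = Ss"
  using inj_mapI[OF rule_code_inj] by (auto simp: inj_def list_encode_eq rules_code_def)

lemma kb_code_eq: "kb_code Rs as = kb_code Ss bs \<longleftrightarrow> Rs = Ss \<and> as = bs"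
  by (simp add: kb_code_def rules_code_eq atoms_code_eq)

end

theory Submission
  imports Defs "HOL-Combinatorics.Transposition"
begin

text \<open>
  In an infinite chase sequence the fact sets increase, so being breadth-first means that every
  trigger active for \<open>F\<^sub>i\<close> is obsolete for \<open>F\<^sub>i\<^sub>+\<^sub>n\<close>, where \<open>n\<close> is the number of these triggers. This
  condition can be checked on finite prefixes. Every step invents at most \<open>k\<close> nulls, with \<open>k\<close>
  depending on the rules only, so after renaming the nulls of \<open>F\<^sub>i\<close> lie below \<open>i * k\<close>. The
  derivations with bounded nulls form a finitely branching tree, and by Koenig's lemma an infinite
  breadth-first sequence exists iff this tree has, for every \<open>N\<close>, a derivation of length \<open>N\<close>
  that satisfies the condition as far as it can be checked. Hence the absence of infinite
  breadth-first sequences is a statement \<open>\<exists>N\<close> over a decidable relation, and termination for all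
  databases is \<open>\<forall>D \<exists>N\<close>. Decidability is shown by writing the bounded search as a list program
  and proving that the functions that are recursive on codes are closed under its constructs.
\<close>

section \<open>Recursive functions of fixed arity\<close>

text \<open>The explicit deadline \<open>i + n\<close> is what makes compactness applicable: a
  violation is visible at a finite index, so a limit of prefixes without violation has none. If
  triggers merely had to become obsolete at some time, limits could lose this property. Nulls are
  renamed by permutations and not by arbitrary maps, because a trigger is active only if it is not
  obsolete, and this negative condition is carried over by the inverse. A separate permutation for
  each \<open>N\<close> is enough, since Koenig's lemma only needs prefixes. On the side of
  recursion theory, every natural number turns out to code some list of rules or atoms. Quantifiers
  over numbers are therefore quantifiers over lists, and well-formedness of these lists becomes part
  of the decidable relation.\<close>

definition rec_fun :: "nat \<Rightarrow> (nat list \<Rightarrow> nat) \<Rightarrow> bool" where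
  "rec_fun k f \<longleftrightarrow> (\<exists>r. \<forall>xs. length xs = k \<longrightarrow> rec_eval r xs (f xs))"

lemma rec_fun_nth: "i < k \<Longrightarrow> rec_fun k (\<lambda>xs. xs ! i)"
  unfolding rec_fun_def by (metis eval_Proj)

lemma rec_fun_zero: "rec_fun k (\<lambda>xs. 0)"
  unfolding rec_fun_def by (metis eval_Zero)

lemma rec_eval_Comp1:
  assumes "rec_eval g xs y" "rec_eval f [y] z"
  shows "rec_eval (Comp f [g]) xs z"
  using assms by (intro eval_Comp[where ys = "[y]"]) auto

lemma rec_fun_comp1:
  assumes "rec_fun 1 f" "rec_fun k g"
  shows "rec_fun k (\<lambda>xs. f [g xs])"
proof -
  from assms obtain r s where "\<forall>xs. length xs = 1 \<longrightarrow> rec_eval r xs (f xs)"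
    "\<forall>xs. length xs = k \<longrightarrow> rec_eval s xs (g xs)"
    unfolding rec_fun_def by blast
  then have "\<forall>xs. length xs = k \<longrightarrow> rec_eval (Comp r [s]) xs (f [g xs])"
    by (auto intro: rec_eval_Comp1)
  then show ?thesis unfolding rec_fun_def by blast
qed

lemma rec_fun_Suc: "rec_fun k f \<Longrightarrow> rec_fun k (\<lambda>xs. Suc (f xs))"
proof -
  have "rec_fun 1 (\<lambda>xs. Suc (hd xs))"
    unfolding rec_fun_def by (rule exI[of _ Succ]) (auto simp: length_Suc_conv intro: eval_Succ)
  moreover assume "rec_fun k f"
  ultimately show ?thesis using rec_fun_comp1 by fastforce
qed

lemma rec_fun_const: "rec_fun k (\<lambda>xs. c)"
  by (induction c) (auto intro: rec_fun_zero rec_fun_Suc)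

lemma rec_fun_rec_nat:
  assumes "rec_fun k f" "rec_fun (Suc (Suc k)) g" "rec_fun k h"
  shows "rec_fun k (\<lambda>xs. rec_nat (f xs) (\<lambda>n y. g (n # y # xs)) (h xs))"
proof -
  obtain rf rg rh where
    r: "\<And>xs. length xs = k \<Longrightarrow> rec_eval rf xs (f xs)"
    "\<And>xs. length xs = Suc (Suc k) \<Longrightarrow> rec_eval rg xs (g xs)"
    "\<And>xs. length xs = k \<Longrightarrow> rec_eval rh xs (h xs)"
    using assms unfolding rec_fun_def by blast
  have *: "rec_eval (PrimRec rf rg) (n # xs) (rec_nat (f xs) (\<lambda>n y. g (n # y # xs)) n)"
    if "length xs = k" for n xs
    by (induction n) (use that r in \<open>auto intro: eval_PrimRec_0 eval_PrimRec_Suc\<close>)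
  \<comment> \<open>\<open>PrimRec\<close> recurses on its first argument, so the argument list
    \<open>h xs # xs\<close> is built from \<open>rh\<close> and all projections of
    \<open>xs\<close>.\<close>
  have "rec_eval (Comp (PrimRec rf rg) (rh # map Proj [0..<k])) xs
      (rec_nat (f xs) (\<lambda>n y. g (n # y # xs)) (h xs))" if "length xs = k" for xs
    by (rule eval_Comp[where ys = "h xs # xs"])
      (use that r * in \<open>auto simp: nth_Cons intro: eval_Proj split: nat.splits\<close>)
  then show ?thesis unfolding rec_fun_def by blast
qed

lemma rec_fun_add: "rec_fun k f \<Longrightarrow> rec_fun k g \<Longrightarrow> rec_fun k (\<lambda>xs. f xs + g xs)"
proof -
  assume *: "rec_fun k f" "rec_fun k g"
  have "rec_nat b (\<lambda>n y. Suc y) a = a + b" for a b by (induction a) auto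
  then show ?thesis
    using rec_fun_rec_nat[OF *(2) rec_fun_Suc[OF rec_fun_nth[of 1]] *(1)] by simp
qed

lemma rec_fun_pred: "rec_fun k f \<Longrightarrow> rec_fun k (\<lambda>xs. f xs - 1)"
proof -
  assume *: "rec_fun k f"
  have "rec_nat 0 (\<lambda>n y. n) a = a - 1" for a by (cases a) auto
  then show ?thesis
    using rec_fun_rec_nat[OF rec_fun_zero rec_fun_nth[of 0] *] by simp
qed

lemma rec_fun_diff: "rec_fun k f \<Longrightarrow> rec_fun k g \<Longrightarrow> rec_fun k (\<lambda>xs. f xs - g xs)"
proof -
  assume *: "rec_fun k f" "rec_fun k g"
  have "rec_nat a (\<lambda>n y. y - 1) b = a - b" for a b by (induction b) auto
  then show ?thesis
    using rec_fun_rec_nat[OF *(1) rec_fun_pred[OF rec_fun_nth[of 1]] *(2)] by simp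
qed

section \<open>Cantor pairing and its inverse\<close>

lemma rec_fun_triangle: "rec_fun k f \<Longrightarrow> rec_fun k (\<lambda>xs. triangle (f xs))"
proof -
  assume *: "rec_fun k f"
  have "rec_nat 0 (\<lambda>n y. y + Suc n) a = triangle a" for a by (induction a) auto
  then show ?thesis
    using rec_fun_rec_nat[OF rec_fun_zero
        rec_fun_add[OF rec_fun_nth[of 1] rec_fun_Suc[OF rec_fun_nth[of 0]]] *] by simp
qed

lemma rec_fun_prod_encode:
  "rec_fun k f \<Longrightarrow> rec_fun k g \<Longrightarrow> rec_fun k (\<lambda>xs. prod_encode (f xs, g xs))"
  unfolding prod_encode_def by (simp add: rec_fun_add rec_fun_triangle)

text \<open>A case distinction is a recursion whose step ignores the counter and the previous value.
  For this \<open>g\<close> is lifted to lists with two additional leading entries.\<close>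

lemma rec_fun_if_zero:
  assumes "rec_fun k f" "rec_fun k g" "rec_fun k h"
  shows "rec_fun k (\<lambda>xs. if h xs = 0 then f xs else g xs)"
proof -
  obtain r where r: "\<And>xs. length xs = k \<Longrightarrow> rec_eval r xs (g xs)"
    using assms(2) unfolding rec_fun_def by blast
  have "rec_eval (Comp r (map (\<lambda>i. Proj (Suc (Suc i))) [0..<k])) xs (g (drop 2 xs))"
    if "length xs = Suc (Suc k)" for xs
  proof (rule eval_Comp[where ys = "drop 2 xs"])
    show "\<forall>i<length (map (\<lambda>i. Proj (Suc (Suc i))) [0..<k]).
        rec_eval (map (\<lambda>i. Proj (Suc (Suc i))) [0..<k] ! i) xs (drop 2 xs ! i)"
    proof (intro allI impI)
      fix i assume "i < length (map (\<lambda>i. Proj (Suc (Suc i))) [0..<k])"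
      then show "rec_eval (map (\<lambda>i. Proj (Suc (Suc i))) [0..<k] ! i) xs (drop 2 xs ! i)"
        using eval_Proj[of "Suc (Suc i)" xs] that by simp
    qed
  qed (use that r in auto)
  then have "rec_fun (Suc (Suc k)) (\<lambda>xs. g (drop 2 xs))" unfolding rec_fun_def by blast
  from rec_fun_rec_nat[OF assms(1) this assms(3)]
  have "rec_fun k (\<lambda>xs. rec_nat (f xs) (\<lambda>n y. g xs) (h xs))" by simp
  moreover have "rec_nat a (\<lambda>n y. b) c = (if c = 0 then a else b)" for a b c :: nat
    by (cases c) auto
  ultimately show ?thesis by simp
qed

text \<open>The largest \<open>r\<close> with \<open>triangle r \<le> n\<close>, in the form of a
  primitive recursion whose test is a truncated difference, so that \<open>rec_fun_if_zero\<close>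
  applies.\<close>

primrec triangle_root :: "nat \<Rightarrow> nat" where
  "triangle_root 0 = 0"
| "triangle_root (Suc n) =
    (if triangle (Suc (triangle_root n)) - Suc n = 0 then Suc (triangle_root n) else triangle_root n)"

lemma triangle_root:
  "triangle (triangle_root n) \<le> n \<and> n < triangle (Suc (triangle_root n))"
  by (induction n) auto

lemma triangle_mono: "m \<le> n \<Longrightarrow> triangle m \<le> triangle n"
  by (induction rule: dec_induct) auto

lemma triangle_root_eq:
  assumes "m \<le> k" shows "triangle_root (triangle k + m) = k"
proof (rule ccontr)
  let ?r = "triangle_root (triangle k + m)"
  assume "?r \<noteq> k"
  then consider "Suc ?r \<le> k" | "Suc k \<le> ?r" by linarith
  then show False
  proof cases
    case 1
    from triangle_mono[OF this] triangle_root[of "triangle k + m"] show False by linarith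
  next
    case 2
    from triangle_mono[OF this] triangle_root[of "triangle k + m"] assms show False by simp
  qed
qed

text \<open>The pairing is \<open>prod_encode (a, b) = triangle (a + b) + a\<close> with
  \<open>a \<le> a + b\<close>, so the root of the code is \<open>a + b\<close>. Both components
  then result from truncated subtraction.\<close>

lemma prod_decode_triangle_root:
  "prod_decode n = (n - triangle (triangle_root n), triangle_root n - (n - triangle (triangle_root n)))"
proof -
  obtain a b where n: "n = prod_encode (a, b)" by (metis prod_decode_inverse surj_pair)
  have "triangle_root n = a + b" unfolding n prod_encode_def by (simp add: triangle_root_eq)
  then show ?thesis by (simp add: n) (simp add: prod_encode_def)
qed

lemma rec_fun_triangle_root: "rec_fun k f \<Longrightarrow> rec_fun k (\<lambda>xs. triangle_root (f xs))"
proof -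
  assume *: "rec_fun k f"
  have "rec_nat 0 (\<lambda>n y. if triangle (Suc y) - Suc n = 0 then Suc y else y) a = triangle_root a"
    for a by (induction a) (auto simp del: triangle_Suc)
  moreover have "rec_fun (Suc (Suc k)) (\<lambda>xs. if triangle (Suc (xs ! 1)) - Suc (xs ! 0) = 0
      then Suc (xs ! 1) else xs ! 1)"
    by (intro rec_fun_if_zero rec_fun_Suc rec_fun_diff rec_fun_triangle rec_fun_nth) auto
  from rec_fun_rec_nat[OF rec_fun_zero this *]
  have "rec_fun k (\<lambda>xs. rec_nat 0 (\<lambda>n y. if triangle (Suc y) - Suc n = 0 then Suc y else y) (f xs))"
    by (simp del: triangle_Suc cong: if_cong)
  ultimately show ?thesis by (simp del: triangle_Suc)
qed

lemma rec_fun_fst_prod_decode: "rec_fun k f \<Longrightarrow> rec_fun k (\<lambda>xs. fst (prod_decode (f xs)))"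
  unfolding prod_decode_triangle_root fst_conv
  by (intro rec_fun_diff rec_fun_triangle rec_fun_triangle_root)

lemma rec_fun_snd_prod_decode: "rec_fun k f \<Longrightarrow> rec_fun k (\<lambda>xs. snd (prod_decode (f xs)))"
  unfolding prod_decode_triangle_root snd_conv
  by (intro rec_fun_diff rec_fun_triangle rec_fun_triangle_root)


section \<open>Computable functions between encoded types\<close>

text \<open>A class lets one set of closure rules serve all types of the list program. The instances
  for terms, atoms and rules are the codes behind \<open>kb_codes\<close> and
  \<open>rules_codes\<close>; injectivity reduces equality tests to numbers.\<close>

class encodable =
  fixes enc :: "'a \<Rightarrow> nat"
  assumes enc_eq_iff [simp]: "enc x = enc y \<longleftrightarrow> x = y"

instantiation nat :: encodable
begin
definition enc_nat :: "nat \<Rightarrow> nat" where "enc_nat n = n"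
instance by standard (simp add: enc_nat_def)
end

instantiation bool :: encodable
begin
definition enc_bool :: "bool \<Rightarrow> nat" where "enc_bool b = (if b then 1 else 0)"
instance by standard (simp add: enc_bool_def)
end

instantiation prod :: (encodable, encodable) encodable
begin
definition enc_prod :: "'a \<times> 'b \<Rightarrow> nat" where "enc_prod p = prod_encode (enc (fst p), enc (snd p))"
instance by standard (auto simp: enc_prod_def prod_eq_iff)
end

instantiation list :: (encodable) encodable
begin
definition enc_list :: "'a list \<Rightarrow> nat" where "enc_list xs = list_encode (map enc xs)"
instance by standard (auto simp: enc_list_def list_encode_eq inj_def dest: map_injective)
end

instantiation trm :: encodable
begin
definition enc_trm :: "trm \<Rightarrow> nat" where "enc_trm = trm_code"
instance by standard (auto simp: enc_trm_def dest: injD[OF trm_code_inj])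
end

instantiation atom :: encodable
begin
definition enc_atom :: "atom \<Rightarrow> nat" where "enc_atom = atom_code"
instance by standard (auto simp: enc_atom_def dest: injD[OF atom_code_inj])
end

instantiation ex_rule :: encodable
begin
definition enc_ex_rule :: "ex_rule \<Rightarrow> nat" where "enc_ex_rule = rule_code"
instance by standard (auto simp: enc_ex_rule_def dest: injD[OF rule_code_inj])
end

definition computable :: "('a::encodable \<Rightarrow> 'b::encodable) \<Rightarrow> bool" where
  "computable f \<longleftrightarrow> (\<exists>g. rec_fun 1 g \<and> (\<forall>x. g [enc x] = enc (f x)))"

named_theorems computable_intros

lemma computableI: "rec_fun 1 g \<Longrightarrow> (\<And>x. g [enc x] = enc (f x)) \<Longrightarrow> computable f"
  unfolding computable_def by blast

lemma computableE:
  assumes "computable f"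
  obtains g where "rec_fun 1 g" "\<And>x. g [enc x] = enc (f x)"
  using assms unfolding computable_def by blast

lemma rec_fun_1_nth: "rec_fun 1 (\<lambda>xs. xs ! 0)"
  by (rule rec_fun_nth) simp

lemma computable_ident [computable_intros]: "computable (\<lambda>x. x)"
  by (rule computableI[OF rec_fun_1_nth]) simp

lemma computable_const [computable_intros]: "computable (\<lambda>x. c)"
  by (rule computableI[OF rec_fun_const[of _ "enc c"]]) simp

lemma computable_enc [computable_intros]: "computable f \<Longrightarrow> computable (\<lambda>x. enc (f x))"
  by (erule computableE, erule computableI) (simp add: enc_nat_def)

lemma computable_comp:
  assumes "computable f" "computable g" shows "computable (\<lambda>x. f (g x))"
proof -
  from assms obtain f' g' where r: "rec_fun 1 f'" "\<And>x. f' [enc x] = enc (f x)"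
    "rec_fun 1 g'" "\<And>x. g' [enc x] = enc (g x)" by (metis computableE)
  show ?thesis by (rule computableI[OF rec_fun_comp1[OF r(1,3)]]) (simp add: r)
qed

lemma computable_Pair [computable_intros]:
  assumes "computable f" "computable g" shows "computable (\<lambda>x. (f x, g x))"
proof -
  from assms obtain f' g' where r: "rec_fun 1 f'" "\<And>x. f' [enc x] = enc (f x)"
    "rec_fun 1 g'" "\<And>x. g' [enc x] = enc (g x)" by (metis computableE)
  show ?thesis by (rule computableI[OF rec_fun_prod_encode[OF r(1,3)]]) (simp add: r enc_prod_def)
qed

lemma computable_fst [computable_intros]: "computable f \<Longrightarrow> computable (\<lambda>x. fst (f x))"
  by (rule computable_comp[where f = fst])
    (rule computableI[OF rec_fun_fst_prod_decode[OF rec_fun_1_nth]], simp add: enc_prod_def)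

lemma computable_snd [computable_intros]: "computable f \<Longrightarrow> computable (\<lambda>x. snd (f x))"
  by (rule computable_comp[where f = snd])
    (rule computableI[OF rec_fun_snd_prod_decode[OF rec_fun_1_nth]], simp add: enc_prod_def)

lemma computable_Suc [computable_intros]: "computable f \<Longrightarrow> computable (\<lambda>x. Suc (f x))"
  by (rule computable_comp[where f = Suc])
    (rule computableI[OF rec_fun_Suc[OF rec_fun_1_nth]], simp add: enc_nat_def)

lemma computable_compose2:
  assumes "computable (\<lambda>p. h (fst p) (snd p))" "computable f" "computable g"
  shows "computable (\<lambda>x. h (f x) (g x))"
  using computable_comp[OF assms(1) computable_Pair[OF assms(2,3)]] by simp

lemma computable_compose3:
  assumes "computable (\<lambda>p. f (fst p) (fst (snd p)) (snd (snd p)))"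
    "computable a" "computable b" "computable c"
  shows "computable (\<lambda>x. f (a x) (b x) (c x))"
  using computable_comp[OF assms(1) computable_Pair[OF assms(2) computable_Pair[OF assms(3,4)]]] by simp

lemma rec_fun_fst_enc: "rec_fun 1 (\<lambda>xs. fst (prod_decode (xs ! 0)))"
  and rec_fun_snd_enc: "rec_fun 1 (\<lambda>xs. snd (prod_decode (xs ! 0)))"
  by (rule rec_fun_fst_prod_decode[OF rec_fun_1_nth], rule rec_fun_snd_prod_decode[OF rec_fun_1_nth])

section \<open>Arithmetic, primitive recursion and Boolean connectives\<close>

lemma computable_add [computable_intros]:
  "computable f \<Longrightarrow> computable g \<Longrightarrow> computable (\<lambda>x. f x + g x :: nat)"
  by (rule computable_compose2[where h = "(+)"])
    (auto intro!: computableI[OF rec_fun_add[OF rec_fun_fst_enc rec_fun_snd_enc]]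
      simp: enc_nat_def enc_prod_def)

lemma computable_diff [computable_intros]:
  "computable f \<Longrightarrow> computable g \<Longrightarrow> computable (\<lambda>x. f x - g x :: nat)"
  by (rule computable_compose2[where h = "(-)"])
    (auto intro!: computableI[OF rec_fun_diff[OF rec_fun_fst_enc rec_fun_snd_enc]]
      simp: enc_nat_def enc_prod_def)

text \<open>In this and all later rules for constructs that bind variables, the body is a function
  of one tuple that holds the bound variables and the context \<open>x\<close>. This keeps
  \<open>computable\<close> a predicate on unary functions.\<close>

lemma computable_rec_nat [computable_intros]:
  assumes "computable f" "computable (\<lambda>p. g (fst p) (fst (snd p)) (snd (snd p)))" "computable h"
  shows "computable (\<lambda>x. rec_nat (f x) (\<lambda>n y. g n y x) (h x))"
proof -
  obtain f' where f': "rec_fun 1 f'" "\<And>x. f' [enc x] = enc (f x)"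
    using computableE[OF assms(1)] by metis
  obtain g' where g': "rec_fun 1 g'" "\<And>p. g' [enc p] = enc (g (fst p) (fst (snd p)) (snd (snd p)))"
    using computableE[OF assms(2)] by metis
  obtain h' where h': "rec_fun 1 h'" "\<And>x. h' [enc x] = enc (h x)"
    using computableE[OF assms(3)] by metis
  have "rec_fun (Suc (Suc 1)) (\<lambda>xs. g' [prod_encode (xs ! 0, prod_encode (xs ! 1, xs ! 2))])"
    by (intro rec_fun_comp1 g'(1) rec_fun_prod_encode rec_fun_nth) auto
  from rec_fun_rec_nat[OF f'(1) this h'(1)] show ?thesis
  proof (rule computableI)
    fix x
    have step: "g' [prod_encode (n, prod_encode (enc y, enc x))] = enc (g n y x)" for n y
      using g'(2)[of "(n, y, x)"] by (simp add: enc_prod_def enc_nat_def)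
    have "rec_nat (f' [enc x]) (\<lambda>n y. g' [prod_encode (n, prod_encode (y, enc x))]) n
        = enc (rec_nat (f x) (\<lambda>n y. g n y x) n)" for n
      by (induction n) (auto simp: step f')
    then show "rec_nat (f' [enc x]) (\<lambda>n y. g' [prod_encode ((n # y # [enc x]) ! 0,
        prod_encode ((n # y # [enc x]) ! 1, (n # y # [enc x]) ! 2))]) (h' [enc x])
        = enc (rec_nat (f x) (\<lambda>n y. g n y x) (h x))"
      by (simp add: h' enc_nat_def)
  qed
qed

lemma computable_if [computable_intros]:
  assumes "computable b" "computable f" "computable g"
  shows "computable (\<lambda>x. if b x then f x else g x)"
proof -
  \<comment> \<open>The code of a Boolean, 0 or 1, serves as the number of iterations.\<close>
  have "computable (\<lambda>x. rec_nat (g x) (\<lambda>_ _. f x) (enc (b x)))"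
    by (intro computable_intros assms computable_comp[OF assms(2)])
  moreover have "rec_nat a (\<lambda>_ _. c) (enc d) = (if d then c else a)" for a c :: 'b and d :: bool
    by (simp add: enc_bool_def)
  ultimately show ?thesis by simp
qed

lemma computable_nat_zero: "computable f \<Longrightarrow> computable (\<lambda>x. f x = (0::nat))"
proof -
  assume *: "computable f"
  have "computable (\<lambda>x. rec_nat True (\<lambda>_ _. False) (f x))" by (intro computable_intros *)
  moreover have "rec_nat True (\<lambda>_ _. False) n = (n = 0)" for n by (cases n) auto
  ultimately show ?thesis by simp
qed

lemma computable_eq [computable_intros]:
  assumes "computable f" "computable g" shows "computable (\<lambda>x. f x = g x)"
proof -
  \<comment> \<open>Values agree iff their codes do, and two numbers agree iff both truncated
    differences vanish.\<close>
  have "computable (\<lambda>x. (enc (f x) - enc (g x)) + (enc (g x) - enc (f x)) = 0)"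
    by (intro computable_nat_zero computable_intros assms)
  moreover have "enc a - enc b + (enc b - enc a) = 0 \<longleftrightarrow> a = b" for a b :: 'b
    using enc_eq_iff[of a b] by linarith
  ultimately show ?thesis by simp
qed

lemma computable_le [computable_intros]:
  assumes "computable f" "computable g" shows "computable (\<lambda>x. f x \<le> (g x :: nat))"
  using computable_nat_zero[OF computable_diff[OF assms]] by simp

lemma computable_less [computable_intros]:
  assumes "computable f" "computable g" shows "computable (\<lambda>x. f x < (g x :: nat))"
  using computable_le[OF computable_Suc[OF assms(1)] assms(2)] by (simp add: Suc_le_eq)

lemma computable_conj [computable_intros]:
  assumes "computable f" "computable g" shows "computable (\<lambda>x. f x \<and> g x)"
  using computable_if[OF assms computable_const[of False]] by (simp add: if_bool_eq_disj cong: conj_cong)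

lemma computable_not [computable_intros]:
  assumes "computable f" shows "computable (\<lambda>x. \<not> f x)"
  using computable_if[OF assms computable_const[of False] computable_const[of True]] by (simp add: if_bool_eq_conj)

lemma computable_imp [computable_intros]:
  assumes "computable f" "computable g" shows "computable (\<lambda>x. f x \<longrightarrow> g x)"
  using computable_if[OF assms computable_const[of True]] by (simp add: if_bool_eq_conj)

lemma computable_Let [computable_intros]:
  "computable (\<lambda>x. f x (g x)) \<Longrightarrow> computable (\<lambda>x. let y = g x in f x y)"
  by simp

lemma computable_case_prod [computable_intros]:
  "computable (\<lambda>x. f x (fst (p x)) (snd (p x))) \<Longrightarrow> computable (\<lambda>x. case p x of (a, b) \<Rightarrow> f x a b)"
  by (simp add: case_prod_beta)

lemma computable_mult [computable_intros]:
  assumes "computable f" "computable g" shows "computable (\<lambda>x. f x * g x :: nat)"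
proof -
  have "computable (\<lambda>x. rec_nat 0 (\<lambda>_ y. g x + y) (f x))"
    by (intro computable_intros assms computable_comp[OF assms(2)])
  moreover have "rec_nat 0 (\<lambda>_ y. b + y) a = a * b" for a b :: nat by (induction a) auto
  ultimately show ?thesis by simp
qed

text \<open>Numbers are their own codes, so it suffices to compute the code of the value as a
  number. The constructors \<open>Cons\<close>, \<open>Var\<close> and \<open>Null\<close> are
  obtained in this way.\<close>

lemma computable_enc_iff: "computable (\<lambda>x. enc (f x)) \<longleftrightarrow> computable f"
  by (simp add: computable_def enc_nat_def)

section \<open>List programs\<close>

lemma computable_case_list [computable_intros]:
  assumes "computable l" "computable f" "computable (\<lambda>p. g (fst p) (fst (snd p)) (snd (snd p)))"
  shows "computable (\<lambda>x. case l x of [] \<Rightarrow> f x | y # ys \<Rightarrow> g x y ys)"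
proof -
  obtain l' where l': "rec_fun 1 l'" "\<And>x. l' [enc x] = enc (l x)"
    using computableE[OF assms(1)] by metis
  obtain f' where f': "rec_fun 1 f'" "\<And>x. f' [enc x] = enc (f x)"
    using computableE[OF assms(2)] by metis
  obtain g' where g': "rec_fun 1 g'" "\<And>p. g' [enc p] = enc (g (fst p) (fst (snd p)) (snd (snd p)))"
    using computableE[OF assms(3)] by metis
  \<comment> \<open>The empty list has code 0, and the predecessor of any other list code is the
    code of the pair of head and tail. Pairing it with the code of \<open>x\<close> gives the
    argument of \<open>g'\<close> without any decoding.\<close>
  have "rec_fun 1 (\<lambda>xs. if l' xs = 0 then f' xs else g' [prod_encode (xs ! 0, l' xs - 1)])"
    by (intro rec_fun_if_zero f' l' rec_fun_comp1 g' rec_fun_prod_encode rec_fun_1_nth rec_fun_pred)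
  then show ?thesis
  proof (rule computableI)
    fix x
    show "(if l' [enc x] = 0 then f' [enc x] else g' [prod_encode ([enc x] ! 0, l' [enc x] - 1)])
      = enc (case l x of [] \<Rightarrow> f x | y # ys \<Rightarrow> g x y ys)"
    proof (cases "l x")
      case Nil
      then show ?thesis by (simp add: l' f' enc_list_def)
    next
      case (Cons y ys)
      then show ?thesis using g'(2)[of "(x, y, ys)"] by (simp add: l' enc_list_def enc_prod_def)
    qed
  qed
qed

lemma computable_Cons [computable_intros]:
  assumes "computable f" "computable g" shows "computable (\<lambda>x. f x # g x)"
proof -
  have "computable (\<lambda>x. Suc (enc (f x, g x)))" by (intro computable_intros assms)
  moreover have "Suc (enc (y, ys)) = enc (y # ys)" for y :: 'b and ys
    by (simp add: enc_list_def enc_prod_def)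
  ultimately show ?thesis by (simp add: computable_enc_iff)
qed

lemma length_le_enc: "length xs \<le> enc xs"
proof (induction xs)
  case (Cons x xs)
  then show ?case using le_prod_encode_2[of "enc xs" "enc x"] by (simp add: enc_list_def)
qed simp

text \<open>Once the list is used up the state no longer changes, so surplus iterations are harmless
  and any bound on the length will do.\<close>

lemma foldl_iterate:
  assumes "length xs \<le> n"
  shows "fst (rec_nat (a, xs) (\<lambda>_ s. case snd s of [] \<Rightarrow> s | y # ys \<Rightarrow> (f (fst s) y, ys)) n) = foldl f a xs"
proof -
  have *: "rec_nat (a, xs) (\<lambda>_ s. case snd s of [] \<Rightarrow> s | y # ys \<Rightarrow> (f (fst s) y, ys)) n
      = (foldl f a (take n xs), drop n xs)"
  proof (induction n)
    case (Suc n)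
    show ?case
    proof (cases "n < length xs")
      case True
      then show ?thesis by (simp add: Suc take_Suc_conv_app_nth Cons_nth_drop_Suc[symmetric])
    qed (simp add: Suc)
  qed simp
  then show ?thesis using assms by simp
qed

text \<open>The code of a list bounds its length and hence serves as the number of iterations.\<close>

lemma computable_foldl [computable_intros]:
  assumes "computable (\<lambda>p. f (fst p) (fst (snd p)) (snd (snd p)))" "computable a" "computable l"
  shows "computable (\<lambda>x. foldl (\<lambda>s y. f x s y) (a x) (l x))"
proof -
  have "computable (\<lambda>x. fst (rec_nat (a x, l x)
      (\<lambda>_ s. case snd s of [] \<Rightarrow> s | y # ys \<Rightarrow> (f x (fst s) y, ys)) (enc (l x))))"
    by (intro computable_intros assms(2,3) computable_compose3[OF assms(1)])
  then show ?thesis by (simp add: foldl_iterate length_le_enc)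
qed

lemma computable_rev [computable_intros]: "computable l \<Longrightarrow> computable (\<lambda>x. rev (l x))"
proof -
  assume *: "computable l"
  have "computable (\<lambda>x. foldl (\<lambda>s y. y # s) [] (l x))" by (intro computable_intros *)
  moreover have "foldl (\<lambda>s y. y # s) ys xs = rev xs @ ys" for xs ys :: "'b list"
    by (induction xs arbitrary: ys) auto
  ultimately show ?thesis by simp
qed

lemma computable_foldr [computable_intros]:
  assumes "computable (\<lambda>p. f (fst p) (fst (snd p)) (snd (snd p)))" "computable l" "computable a"
  shows "computable (\<lambda>x. foldr (\<lambda>y s. f x y s) (l x) (a x))"
proof -
  have "computable (\<lambda>x. foldl (\<lambda>s y. f x y s) (a x) (rev (l x)))"
    by (intro computable_intros assms(2,3) computable_compose3[OF assms(1)])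
  then show ?thesis by (simp add: foldr_conv_foldl)
qed

lemma computable_append [computable_intros]:
  assumes "computable f" "computable g" shows "computable (\<lambda>x. f x @ g x)"
proof -
  have "computable (\<lambda>x. foldr (\<lambda>y s. y # s) (f x) (g x))" by (intro computable_intros assms)
  moreover have "foldr (\<lambda>y s. y # s) xs ys = xs @ ys" for xs ys :: "'b list"
    by (induction xs) auto
  ultimately show ?thesis by simp
qed

lemma computable_concat [computable_intros]:
  assumes "computable f" shows "computable (\<lambda>x. concat (f x))"
  unfolding concat_conv_foldr by (intro computable_intros assms)

lemma computable_map [computable_intros]:
  assumes "computable (\<lambda>p. f (fst p) (snd p))" "computable l"
  shows "computable (\<lambda>x. map (\<lambda>y. f x y) (l x))"
proof -
  have "computable (\<lambda>x. foldr (\<lambda>y s. f x y # s) (l x) [])"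
    by (intro computable_intros assms(2) computable_compose2[OF assms(1)])
  moreover have "foldr (\<lambda>y s. g y # s) xs [] = map g xs" for g :: "'b \<Rightarrow> 'c" and xs
    by (induction xs) auto
  ultimately show ?thesis by simp
qed

lemma computable_filter [computable_intros]:
  assumes "computable (\<lambda>p. f (fst p) (snd p))" "computable l"
  shows "computable (\<lambda>x. filter (\<lambda>y. f x y) (l x))"
proof -
  have "computable (\<lambda>x. foldr (\<lambda>y s. if f x y then y # s else s) (l x) [])"
    by (intro computable_intros assms(2) computable_compose2[OF assms(1)])
  moreover have "foldr (\<lambda>y s. if g y then y # s else s) xs [] = filter g xs" for g :: "'b \<Rightarrow> bool" and xs
    by (induction xs) auto
  ultimately show ?thesis by simp
qed

lemma computable_ball [computable_intros]:
  assumes "computable (\<lambda>p. f (fst p) (snd p))" "computable l"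
  shows "computable (\<lambda>x. \<forall>y\<in>set (l x). f x y)"
proof -
  have "computable (\<lambda>x. filter (\<lambda>y. \<not> f x y) (l x) = [])"
    by (intro computable_intros assms(2) computable_compose2[OF assms(1)])
  then show ?thesis by (simp add: filter_empty_conv)
qed

lemma computable_bex [computable_intros]:
  assumes "computable (\<lambda>p. f (fst p) (snd p))" "computable l"
  shows "computable (\<lambda>x. \<exists>y\<in>set (l x). f x y)"
proof -
  have "computable (\<lambda>x. \<not> (\<forall>y\<in>set (l x). \<not> f x y))"
    by (intro computable_intros assms(2) computable_compose2[OF assms(1)])
  then show ?thesis by simp
qed

lemma computable_mem [computable_intros]:
  assumes "computable f" "computable l"
  shows "computable (\<lambda>x. f x \<in> set (l x))"
proof -
  have "computable (\<lambda>x. \<exists>y\<in>set (l x). f x = y)"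
    by (intro computable_intros assms(2) computable_comp[OF assms(1)])
  then show ?thesis by simp
qed

lemma computable_remdups [computable_intros]:
  assumes "computable l" shows "computable (\<lambda>x. remdups (l x))"
proof -
  have "computable (\<lambda>x. foldr (\<lambda>y s. if y \<in> set s then s else y # s) (l x) [])"
    by (intro computable_intros assms)
  moreover have "foldr (\<lambda>y s. if y \<in> set s then s else y # s) xs [] = remdups xs" for xs :: "'b list"
    by (induction xs) auto
  ultimately show ?thesis by simp
qed

lemma computable_length [computable_intros]:
  assumes "computable l" shows "computable (\<lambda>x. length (l x))"
proof -
  have "computable (\<lambda>x. foldr (\<lambda>y s. Suc s) (l x) 0)"
    by (intro computable_intros assms)
  moreover have "foldr (\<lambda>y s. Suc s) xs 0 = length xs" for xs :: "'b list"
    by (induction xs) auto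
  ultimately show ?thesis by simp
qed

lemma computable_upt [computable_intros]:
  assumes "computable f" shows "computable (\<lambda>x. [0..<f x])"
proof -
  have "computable (\<lambda>x. rec_nat [] (\<lambda>n s. s @ [n]) (f x))"
    by (intro computable_intros assms)
  moreover have "rec_nat [] (\<lambda>n s. s @ [n]) n = [0..<n]" for n :: nat
    by (induction n) auto
  ultimately show ?thesis by simp
qed

text \<open>\<open>hd []\<close> is an unspecified constant, whereas \<open>xs ! n\<close> out of range need not be computable
  in \<open>n\<close>; list access is therefore expressed through \<open>hd\<close> and \<open>drop\<close>.\<close>

lemma computable_hd [computable_intros]:
  assumes "computable l" shows "computable (\<lambda>x. hd (l x))"
proof -
  have "computable (\<lambda>x. case l x of [] \<Rightarrow> hd [] | y # ys \<Rightarrow> y)"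
    by (intro computable_intros assms)
  moreover have "(case xs of [] \<Rightarrow> hd [] | y # ys \<Rightarrow> y) = hd xs" for xs :: "'b list"
    by (cases xs) auto
  ultimately show ?thesis by simp
qed

lemma computable_drop [computable_intros]:
  assumes "computable n" "computable l" shows "computable (\<lambda>x. drop (n x) (l x))"
proof -
  have "computable (\<lambda>x. rec_nat (l x) (\<lambda>_ s. case s of [] \<Rightarrow> [] | y # ys \<Rightarrow> ys) (n x))"
    by (intro computable_intros assms)
  moreover have "(case s of [] \<Rightarrow> [] | y # ys \<Rightarrow> ys) = tl s" for s :: "'b list"
    by (cases s) auto
  moreover have "rec_nat xs (\<lambda>_. tl) n = drop n xs" for n and xs :: "'b list"
    by (induction n) (auto simp: drop_Suc tl_drop)
  ultimately show ?thesis by simp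
qed

lemma computable_distinct [computable_intros]:
  assumes "computable l" shows "computable (\<lambda>x. distinct (l x))"
proof -
  have "computable (\<lambda>x. length (remdups (l x)) = length (l x))"
    by (intro computable_intros assms)
  then show ?thesis by (simp add: length_remdups_eq)
qed

section \<open>Terms, atoms and rules\<close>

lemma divmod3_iterate:
  "rec_nat (0, 0) (\<lambda>_ s. if snd s = 2 then (Suc (fst s), 0) else (fst s, Suc (snd s))) n
    = (n div 3, n mod 3)"
  by (induction n) (auto simp: div_Suc mod_Suc)

lemma computable_div3: "computable f \<Longrightarrow> computable (\<lambda>x. f x div 3 :: nat)"
  and computable_mod3: "computable f \<Longrightarrow> computable (\<lambda>x. f x mod 3 :: nat)"
proof -
  assume *: "computable f"
  let ?r = "\<lambda>x. rec_nat (0, 0) (\<lambda>_ s. if snd s = 2 then (Suc (fst s), 0) else (fst s, Suc (snd s))) (f x)"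
  have "computable (\<lambda>x. fst (?r x))" "computable (\<lambda>x. snd (?r x))"
    by (intro computable_intros *)+
  then show "computable (\<lambda>x. f x div 3)" "computable (\<lambda>x. f x mod 3)"
    by (simp_all add: divmod3_iterate)
qed

text \<open>\<open>trm_code\<close> keeps the constructor in the residue modulo 3 and the index in
  the quotient.\<close>

lemma computable_case_trm [computable_intros]:
  assumes "computable t" "computable (\<lambda>p. f (fst p) (snd p))" "computable (\<lambda>p. g (fst p) (snd p))"
    "computable (\<lambda>p. h (fst p) (snd p))"
  shows "computable (\<lambda>x. case t x of Var n \<Rightarrow> f x n | Const n \<Rightarrow> g x n | Null n \<Rightarrow> h x n)"
proof -
  have "computable (\<lambda>x. if enc (t x) mod 3 = 0 then f x (enc (t x) div 3)
      else if enc (t x) mod 3 = 1 then g x (enc (t x) div 3) else h x (enc (t x) div 3))"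
    by (intro computable_intros computable_div3 computable_mod3 assms(1)
        computable_compose2[OF assms(2)] computable_compose2[OF assms(3)] computable_compose2[OF assms(4)])
  moreover have "(if enc t mod 3 = 0 then a (enc t div 3)
      else if enc t mod 3 = 1 then b (enc t div 3) else c (enc t div 3))
      = (case t of Var n \<Rightarrow> a n | Const n \<Rightarrow> b n | Null n \<Rightarrow> c n)" for a b c :: "nat \<Rightarrow> 'b" and t
  proof (cases t)
    case (Const n)
    have "(3 * n + 1) mod 3 = 1" "(3 * n + 1) div 3 = n" by presburger+
    then show ?thesis by (simp add: Const enc_trm_def)
  next
    case (Null n)
    have "(3 * n + 2) mod 3 = 2" "(3 * n + 2) div 3 = n" by presburger+
    then show ?thesis by (simp add: Null enc_trm_def)
  qed (simp add: enc_trm_def)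
  ultimately show ?thesis by simp
qed

lemma computable_Var [computable_intros]:
  assumes "computable f" shows "computable (\<lambda>x. Var (f x))"
proof -
  have "computable (\<lambda>x. 3 * f x)" by (intro computable_intros assms)
  then show ?thesis by (subst computable_enc_iff[symmetric]) (simp add: enc_trm_def)
qed

lemma computable_Null [computable_intros]:
  assumes "computable f" shows "computable (\<lambda>x. Null (f x))"
proof -
  have "computable (\<lambda>x. 3 * f x + 2)" by (intro computable_intros assms)
  then show ?thesis by (subst computable_enc_iff[symmetric]) (simp add: enc_trm_def)
qed

text \<open>Since an atom has the code of the pair of its components, constructor and selectors
  inherit their computability from pairs. The same device is used for rules.\<close>

lemma enc_atom_eq: "enc a = enc (pname a, args a)"
  by (simp add: enc_atom_def atom_code_def enc_prod_def enc_nat_def enc_list_def enc_trm_def)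

lemma enc_ex_rule_eq: "enc R = enc (body R, head R)"
  by (simp add: enc_ex_rule_def rule_code_def enc_prod_def atoms_code_def enc_list_def enc_atom_def)

lemma computable_Atom [computable_intros]:
  assumes "computable f" "computable g" shows "computable (\<lambda>x. Atom (f x) (g x))"
  using computable_Pair[OF assms] by (simp add: computable_def enc_atom_eq)

lemma computable_atom_components: "computable f \<Longrightarrow> computable (\<lambda>x. (pname (f x), args (f x)))"
  by (simp add: computable_def enc_atom_eq)

lemma computable_pname [computable_intros]: "computable f \<Longrightarrow> computable (\<lambda>x. pname (f x))"
  using computable_fst[OF computable_atom_components[of f]] by simp

lemma computable_args [computable_intros]: "computable f \<Longrightarrow> computable (\<lambda>x. args (f x))"
  using computable_snd[OF computable_atom_components[of f]] by simp

lemma computable_rule_components: "computable f \<Longrightarrow> computable (\<lambda>x. (body (f x), head (f x)))"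
  by (simp add: computable_def enc_ex_rule_eq)

lemma computable_body [computable_intros]: "computable f \<Longrightarrow> computable (\<lambda>x. body (f x))"
  using computable_fst[OF computable_rule_components[of f]] by simp

lemma computable_head [computable_intros]: "computable f \<Longrightarrow> computable (\<lambda>x. head (f x))"
  using computable_snd[OF computable_rule_components[of f]] by simp

section \<open>The chase on lists of facts\<close>

definition trms :: "atom list \<Rightarrow> trm list" where
  "trms F = concat (map args F)"

definition var_list :: "atom list \<Rightarrow> nat list" where
  "var_list F = remdups (concat (map (\<lambda>t. case t of Var v \<Rightarrow> [v] | Const c \<Rightarrow> [] | Null n \<Rightarrow> []) (trms F)))"

definition univ_list :: "ex_rule \<Rightarrow> nat list" where
  "univ_list R = var_list (body R)"

definition exis_list :: "ex_rule \<Rightarrow> nat list" where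
  "exis_list R = filter (\<lambda>v. v \<notin> set (univ_list R)) (var_list (head R))"

text \<open>Substitutions become association lists with keys in the order of \<open>vs\<close>. For
  distinct \<open>vs\<close> this makes the list determined by the map, which is what permits
  counting triggers by counting lists.\<close>

definition substs :: "nat list \<Rightarrow> trm list \<Rightarrow> (nat \<times> trm) list list" where
  "substs vs ts = foldr (\<lambda>v S. concat (map (\<lambda>s. map (\<lambda>t. (v, t) # s) ts) S)) vs [[]]"

definition loaded_list :: "atom list \<Rightarrow> ex_rule \<Rightarrow> (nat \<times> trm) list \<Rightarrow> bool" where
  "loaded_list F R s \<longleftrightarrow> (\<forall>a\<in>set (body R). apply_atom (map_of s) a \<in> set F)"

text \<open>It suffices to try the terms of \<open>F\<close>: each existential variable occurs in
  the head, so its value occurs in the image of the head, which has to lie in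
  \<open>F\<close>.\<close>

definition obsolete_list :: "atom list \<Rightarrow> ex_rule \<Rightarrow> (nat \<times> trm) list \<Rightarrow> bool" where
  "obsolete_list F R s \<longleftrightarrow>
    (\<exists>e\<in>set (substs (exis_list R) (trms F)). \<forall>a\<in>set (head R). apply_atom (map_of (e @ s)) a \<in> set F)"

text \<open>The length of this list stands for the cardinality in the definition of breadth-first
  sequences. As \<open>Rs\<close> and \<open>trms F\<close> may have repeated entries,
  \<open>remdups\<close> is essential.\<close>

definition active_list :: "ex_rule list \<Rightarrow> atom list \<Rightarrow> (ex_rule \<times> (nat \<times> trm) list) list" where
  "active_list Rs F = remdups (concat (map (\<lambda>R. map (\<lambda>s. (R, s))
     (filter (\<lambda>s. loaded_list F R s \<and> \<not> obsolete_list F R s) (substs (univ_list R) (trms F)))) Rs))"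

text \<open>A trigger has infinitely many outputs, one for each choice of fresh nulls. The cap
  \<open>M\<close> on the nulls leaves finitely many.\<close>

definition successors :: "ex_rule list \<Rightarrow> nat \<Rightarrow> atom list \<Rightarrow> atom list list" where
  "successors Rs M F = concat (map (\<lambda>(R, s). map (\<lambda>e. F @ map (\<lambda>a. apply_atom (map_of (e @ s)) a) (head R))
     (filter (\<lambda>e. distinct (map snd e) \<and> (\<forall>t\<in>set (map snd e). t \<notin> set (trms F)))
       (substs (exis_list R) (map Null [0..<M])))) (active_list Rs F))"

section \<open>Agreement of the list notions with the set notions\<close>

lemma set_var_list: "set (var_list F) = vars_atoms (set F)"
  unfolding var_list_def vars_atoms_def trms_def by (force split: trm.splits)

lemma distinct_univ_list: "distinct (univ_list R)"
  by (simp add: univ_list_def var_list_def)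

lemma distinct_exis_list: "distinct (exis_list R)"
  by (simp add: exis_list_def var_list_def)

lemma set_univ_list: "set (univ_list R) = univ_vars R"
  by (simp add: univ_list_def univ_vars_def set_var_list)

lemma set_exis_list: "set (exis_list R) = exis_vars R"
  by (auto simp: exis_list_def exis_vars_def set_univ_list set_var_list)

lemma mem_substs: "s \<in> set (substs vs ts) \<longleftrightarrow> map fst s = vs \<and> snd ` set s \<subseteq> set ts"
proof (induction vs arbitrary: s)
  case (Cons v vs)
  have "s \<in> set (substs (v # vs) ts) \<longleftrightarrow> (\<exists>s' t. s' \<in> set (substs vs ts) \<and> t \<in> set ts \<and> s = (v, t) # s')"
    by (auto simp: substs_def)
  then show ?case unfolding Cons.IH by (cases s) auto
qed (auto simp: substs_def)

lemma map_of_inject_keys: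
  assumes "map_of s = map_of s'" "map fst s = map fst s'" "distinct (map fst s)"
  shows "s = s'"
  using assms
proof (induction s arbitrary: s')
  case (Cons p s)
  obtain v t where p: "p = (v, t)" by force
  obtain t' s'' where s': "s' = (v, t') # s''" using Cons.prems(2) p by (cases s') auto
  have "t = t'" using fun_cong[OF Cons.prems(1), of v] by (simp add: p s')
  have "v \<notin> set (map fst s)" "v \<notin> set (map fst s'')"
    using Cons.prems(2,3) by (metis distinct.simps(2) fst_conv list.inject list.simps(9) p s')+
  then have nv: "map_of s v = None" "map_of s'' v = None" by (simp_all add: map_of_eq_None_iff)
  \<comment> \<open>Both tails are undefined at \<open>v\<close>, so each is recovered from the
    common map by deleting \<open>v\<close>.\<close>
  have "map_of s = (map_of (p # s))(v := None)" "map_of s'' = (map_of s')(v := None)"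
    using nv by (auto simp: p s' fun_eq_iff)
  then have "map_of s = map_of s''" by (metis Cons.prems(1))
  then have "s = s''" using Cons.IH Cons.prems(2,3) s' by simp
  then show ?case by (simp add: p s' \<open>t = t'\<close>)
qed simp

lemma term_of_applied_atom:
  assumes "Var v \<in> set (args a)" "\<sigma> v = Some t"
  shows "t \<in> set (args (apply_atom \<sigma> a))"
proof -
  have "apply_trm \<sigma> (Var v) \<in> set (args (apply_atom \<sigma> a))"
    using assms(1) unfolding apply_atom_def by (simp del: apply_trm.simps)
  then show ?thesis using assms(2) by simp
qed

text \<open>Every universal variable occurs in the body, whose image lies in \<open>F\<close>. Hence
  enumerating substitutions over \<open>trms F\<close> misses no loaded trigger.\<close>

lemma ran_loaded:
  assumes "dom \<sigma> = univ_vars R" "loaded (R, \<sigma>) F"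
  shows "ran \<sigma> \<subseteq> (\<Union>a\<in>F. set (args a))"
proof
  fix t assume "t \<in> ran \<sigma>"
  then obtain v where v: "\<sigma> v = Some t" by (auto simp: ran_def)
  then obtain a where "a \<in> set (body R)" "Var v \<in> set (args a)"
    using assms(1) unfolding univ_vars_def vars_atoms_def by blast
  then show "t \<in> (\<Union>a\<in>F. set (args a))"
    using term_of_applied_atom[of v _ \<sigma> t] v assms(2) unfolding loaded_def by blast
qed

lemma set_trms: "set (trms F) = (\<Union>a\<in>set F. set (args a))"
  by (simp add: trms_def)

lemma ran_map_of: "ran (map_of s) \<subseteq> snd ` set s"
  by (force simp: ran_def dest: map_of_SomeD)

lemma map_of_tabulate:
  "map_of (map (\<lambda>v. (v, f v)) vs) = (\<lambda>v. if v \<in> set vs then Some (f v) else None)"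
  by (induction vs) auto

lemma extension_to_exis_append:
  assumes "map fst s = univ_list R" "map fst e = exis_list R" "\<forall>t\<in>snd ` set s \<union> snd ` set e. var_free t"
  shows "extension_to_exis (R, map_of s) (map_of (e @ s))"
proof -
  have d: "dom (map_of s) = univ_vars R" "dom (map_of e) = exis_vars R"
    using assms(1,2) set_univ_list[of R] set_exis_list[of R]
    by (metis dom_map_of_conv_image_fst set_map)+
  \<comment> \<open>In \<open>e @ s\<close> the entries of \<open>e\<close> take precedence, but
    existential and universal variables are disjoint, so nothing of \<open>s\<close> is
    overridden.\<close>
  have "map_of s \<subseteq>\<^sub>m map_of s ++ map_of e"
    using d by (auto simp: map_le_def map_add_def exis_vars_def split: option.splits)
  moreover have "\<forall>t\<in>ran (map_of (e @ s)). var_free t"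
    using ran_map_of[of "e @ s"] assms(3) by (simp only: set_append image_Un) blast
  ultimately show ?thesis using d
    unfolding extension_to_exis_def substitution_on_def by auto
qed

lemma extension_to_exis_map_of:
  assumes "extension_to_exis (R, map_of s) \<sigma>'" "map fst s = univ_list R"
  shows "map_of (map (\<lambda>v. (v, the (\<sigma>' v))) (exis_list R) @ s) = \<sigma>'"
proof
  fix v
  have d: "dom \<sigma>' = univ_vars R \<union> exis_vars R" "map_of s \<subseteq>\<^sub>m \<sigma>'"
    using assms(1) by (auto simp: extension_to_exis_def substitution_on_def)
  have ds: "dom (map_of s) = univ_vars R"
    using assms(2) set_univ_list[of R] by (metis dom_map_of_conv_image_fst set_map)
  have "map_of s v = \<sigma>' v" if "v \<notin> exis_vars R"
    using that d ds by (metis Un_iff domIff map_le_def)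
  moreover have "\<sigma>' v \<noteq> None" if "v \<in> exis_vars R" using d(1) that by auto
  ultimately show "map_of (map (\<lambda>v. (v, the (\<sigma>' v))) (exis_list R) @ s) v = \<sigma>' v"
    by (auto simp: map_add_def map_of_tabulate set_exis_list split: option.splits)
qed

lemma loaded_list_iff: "loaded_list F R s \<longleftrightarrow> loaded (R, map_of s) (set F)"
  by (auto simp: loaded_list_def loaded_def)

text \<open>That \<open>F\<close> consists of facts makes each match over \<open>trms F\<close>
  variable-free, as \<open>substitution_on\<close> demands. Conversely, a match is forced to take
  its existential values from \<open>trms F\<close>.\<close>

lemma obsolete_list_iff:
  assumes "\<forall>a\<in>set F. is_fact a" "map fst s = univ_list R" "\<forall>t\<in>snd ` set s. var_free t"
  shows "obsolete_list F R s \<longleftrightarrow> obsolete (R, map_of s) (set F)"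
proof
  assume "obsolete_list F R s"
  then obtain e where "e \<in> set (substs (exis_list R) (trms F))"
    "\<forall>a\<in>set (head R). apply_atom (map_of (e @ s)) a \<in> set F"
    unfolding obsolete_list_def by blast
  then have e: "map fst e = exis_list R" "snd ` set e \<subseteq> set (trms F)"
    "\<forall>a\<in>set (head R). apply_atom (map_of (e @ s)) a \<in> set F"
    by (simp_all only: mem_substs)
  have "\<forall>t\<in>snd ` set e. var_free t" using e(2) assms(1) by (auto simp: set_trms is_fact_def)
  with e(1) assms(2,3) have "extension_to_exis (R, map_of s) (map_of (e @ s))"
    by (intro extension_to_exis_append) auto
  then show "obsolete (R, map_of s) (set F)" using e(3) unfolding obsolete_def by auto
next
  assume "obsolete (R, map_of s) (set F)"
  then obtain \<sigma>' where \<sigma>': "extension_to_exis (R, map_of s) \<sigma>'" "apply_atom \<sigma>' ` set (head R) \<subseteq> set F"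
    unfolding obsolete_def by auto
  let ?e = "map (\<lambda>v. (v, the (\<sigma>' v))) (exis_list R)"
  have "the (\<sigma>' v) \<in> set (trms F)" if v: "v \<in> exis_vars R" for v
  proof -
    obtain a where a: "a \<in> set (head R)" "Var v \<in> set (args a)"
      using v unfolding exis_vars_def vars_atoms_def by blast
    have "v \<in> dom \<sigma>'" using \<sigma>'(1) v by (simp add: extension_to_exis_def substitution_on_def)
    then have "\<sigma>' v = Some (the (\<sigma>' v))" by auto
    with a(2) have "the (\<sigma>' v) \<in> set (args (apply_atom \<sigma>' a))" by (rule term_of_applied_atom)
    then show ?thesis using a(1) \<sigma>'(2) by (auto simp: set_trms)
  qed
  then have "?e \<in> set (substs (exis_list R) (trms F))"
    by (auto simp: mem_substs set_exis_list comp_def)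
  then show "obsolete_list F R s"
    using \<sigma>'(2) extension_to_exis_map_of[OF \<sigma>'(1) assms(2)] unfolding obsolete_list_def by force
qed

lemma mem_active_list:
  "(R, s) \<in> set (active_list Rs F) \<longleftrightarrow> R \<in> set Rs \<and> map fst s = univ_list R \<and>
     snd ` set s \<subseteq> set (trms F) \<and> loaded_list F R s \<and> \<not> obsolete_list F R s"
  unfolding active_list_def by (auto simp: mem_substs)

lemma distinct_active_list: "distinct (active_list Rs F)"
  by (simp add: active_list_def)

lemma map_of_tabulate_dom:
  assumes "dom \<sigma> = set vs"
  shows "map_of (map (\<lambda>v. (v, the (\<sigma> v))) vs) = \<sigma>"
proof
  fix v
  have "v \<in> set vs \<longleftrightarrow> \<sigma> v \<noteq> None" using assms by blast
  then show "map_of (map (\<lambda>v. (v, the (\<sigma> v))) vs) v = \<sigma> v"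
    by (auto simp: map_of_tabulate)
qed

lemma active_triggers_list:
  assumes "\<forall>a\<in>set F. is_fact a"
  shows "active_triggers (set Rs) (set F) = (\<lambda>(R, s). (R, map_of s)) ` set (active_list Rs F)"
proof (intro set_eqI iffI)
  fix \<tau> assume "\<tau> \<in> active_triggers (set Rs) (set F)"
  then obtain R \<sigma> where \<tau>: "\<tau> = (R, \<sigma>)" "R \<in> set Rs" "dom \<sigma> = univ_vars R" "\<forall>t\<in>ran \<sigma>. var_free t"
    "loaded (R, \<sigma>) (set F)" "\<not> obsolete (R, \<sigma>) (set F)"
    unfolding active_triggers_def triggers_def substitution_on_def by auto
  let ?s = "map (\<lambda>v. (v, the (\<sigma> v))) (univ_list R)"
  have s: "map_of ?s = \<sigma>" using \<tau>(3) by (simp add: map_of_tabulate_dom set_univ_list)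
  have ran: "snd ` set ?s \<subseteq> ran \<sigma>" using \<tau>(3) by (force simp: set_univ_list intro: ranI)
  have vf: "\<forall>t\<in>snd ` set ?s. var_free t" using ran \<tau>(4) by blast
  have "(R, ?s) \<in> set (active_list Rs F)"
    unfolding mem_active_list
  proof (intro conjI)
    show "snd ` set ?s \<subseteq> set (trms F)"
      using ran ran_loaded[OF \<tau>(3,5)] by (auto simp: set_trms)
    show "loaded_list F R ?s" using \<tau>(5) by (simp add: loaded_list_iff s)
    show "\<not> obsolete_list F R ?s"
      using \<tau>(6) obsolete_list_iff[OF assms _ vf, of R] by (simp add: comp_def s)
  qed (use \<tau> in \<open>auto simp: comp_def\<close>)
  then show "\<tau> \<in> (\<lambda>(R, s). (R, map_of s)) ` set (active_list Rs F)"
    using s \<tau>(1) by (force intro!: image_eqI[where x = "(R, ?s)"])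
next
  fix \<tau> assume "\<tau> \<in> (\<lambda>(R, s). (R, map_of s)) ` set (active_list Rs F)"
  then obtain R s where \<tau>: "\<tau> = (R, map_of s)" "R \<in> set Rs" "map fst s = univ_list R"
     "snd ` set s \<subseteq> set (trms F)" "loaded_list F R s" "\<not> obsolete_list F R s"
    by (auto simp: mem_active_list)
  have vf: "\<forall>t\<in>snd ` set s. var_free t" using \<tau>(4) assms by (auto simp: set_trms is_fact_def)
  moreover have "dom (map_of s) = univ_vars R"
    using \<tau>(3) set_univ_list[of R] by (metis dom_map_of_conv_image_fst set_map)
  ultimately show "\<tau> \<in> active_triggers (set Rs) (set F)"
    using \<tau> obsolete_list_iff[OF assms \<tau>(3) vf] ran_map_of[of s]
    unfolding active_triggers_def triggers_def substitution_on_def by (auto simp: loaded_list_iff)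
qed

lemma card_active_triggers_list:
  assumes "\<forall>a\<in>set F. is_fact a"
  shows "card (active_triggers (set Rs) (set F)) = length (active_list Rs F)"
proof -
  have "inj_on (\<lambda>(R, s). (R, map_of s)) (set (active_list Rs F))"
    by (auto intro!: inj_onI simp: mem_active_list distinct_univ_list intro: map_of_inject_keys)
  then show ?thesis
    unfolding active_triggers_list[OF assms] by (simp add: card_image distinct_card distinct_active_list)
qed

lemma Null_mem_trms: "Null n \<in> set (trms F) \<longleftrightarrow> n \<in> nulls_atoms (set F)"
  by (auto simp: set_trms nulls_atoms_def)

lemma mem_successors:
  "G \<in> set (successors Rs M F) \<longleftrightarrow> (\<exists>R s e. (R, s) \<in> set (active_list Rs F) \<and>
     map fst e = exis_list R \<and> snd ` set e \<subseteq> Null ` {0..<M} \<and> distinct (map snd e) \<and>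
     (\<forall>t\<in>snd ` set e. t \<notin> set (trms F)) \<and> G = F @ map (apply_atom (map_of (e @ s))) (head R))"
  (is "_ \<longleftrightarrow> ?rhs")
proof -
  have "G \<in> set (successors Rs M F) \<longleftrightarrow> (\<exists>p e. p \<in> set (active_list Rs F) \<and>
     e \<in> set (substs (exis_list (fst p)) (map Null [0..<M])) \<and> distinct (map snd e) \<and>
     (\<forall>t\<in>set (map snd e). t \<notin> set (trms F)) \<and>
     G = F @ map (apply_atom (map_of (e @ snd p))) (head (fst p)))"
    unfolding successors_def case_prod_beta
    by (simp add: image_iff Bex_def conj_ac del: map_of_append split_paired_Ex) blast
  then show ?thesis by (simp add: mem_substs del: map_of_append)
qed

lemma successors_chase_step:
  assumes "\<forall>a\<in>set F. is_fact a" "G \<in> set (successors Rs M F)"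
  shows "chase_step (set Rs) (set F) (set G)"
proof -
  obtain R s e where Rs: "(R, s) \<in> set (active_list Rs F)" "map fst e = exis_list R"
    "snd ` set e \<subseteq> Null ` {0..<M}" "distinct (map snd e)" "\<forall>t\<in>snd ` set e. t \<notin> set (trms F)"
    "G = F @ map (apply_atom (map_of (e @ s))) (head R)"
    using assms(2) unfolding mem_successors by blast
  have act: "(R, map_of s) \<in> active_triggers (set Rs) (set F)"
    using Rs(1) unfolding active_triggers_list[OF assms(1)] by force
  have s: "map fst s = univ_list R" "snd ` set s \<subseteq> set (trms F)"
    using Rs(1) by (auto simp: mem_active_list)
  have "\<forall>t\<in>snd ` set s. var_free t" using s(2) assms(1) by (auto simp: set_trms is_fact_def)
  moreover have "\<forall>t\<in>snd ` set e. var_free t" using Rs(3) by auto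
  ultimately have ext: "extension_to_exis (R, map_of s) (map_of (e @ s))"
    using s(1) Rs(2) by (intro extension_to_exis_append) auto
  have dist: "distinct (map fst e)" unfolding Rs(2) by (rule distinct_exis_list)
  have "\<exists>n. (z, Null n) \<in> set e" if "z \<in> exis_vars R" for z
  proof -
    have "z \<in> fst ` set e" using that Rs(2) set_exis_list by (metis set_map)
    then obtain t where "(z, t) \<in> set e" by force
    moreover have "t \<in> Null ` {0..<M}" using calculation Rs(3) by force
    ultimately show ?thesis by auto
  qed
  then obtain \<nu> where \<nu>: "\<And>z. z \<in> exis_vars R \<Longrightarrow> (z, Null (\<nu> z)) \<in> set e" by metis
  have "inj_on \<nu> (exis_vars R)"
  proof (rule inj_onI)
    fix y z assume yz: "y \<in> exis_vars R" "z \<in> exis_vars R" "\<nu> y = \<nu> z"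
    have "inj_on snd (set e)" using Rs(4) by (simp add: distinct_map)
    from inj_onD[OF this _ \<nu>[OF yz(1)] \<nu>[OF yz(2)]] show "y = z" using yz(3) by simp
  qed
  moreover have "map_of (e @ s) z = Some (Null (\<nu> z)) \<and> \<nu> z \<notin> nulls_atoms (set F)"
    if z: "z \<in> exis_vars R" for z
    using \<nu>[OF z] Rs(5) map_of_is_SomeI[OF dist \<nu>[OF z]]
    by (force simp: map_add_def Null_mem_trms[symmetric])
  ultimately have "is_output (R, map_of s) (set F) (apply_atom (map_of (e @ s)) ` set (head R))"
    using ext unfolding is_output_def by auto
  then show ?thesis using act unfolding chase_step_def Rs(6) by auto
qed

text \<open>Completeness needs the cap on the nulls of \<open>F'\<close>: an invented null belongs
  to a variable of the head, hence occurs in \<open>F'\<close> and is below \<open>M\<close>.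
  Soundness, in \<open>successors_chase_step\<close>, holds for every \<open>M\<close>.\<close>

lemma chase_step_successors:
  assumes "\<forall>a\<in>set F. is_fact a" "chase_step (set Rs) (set F) F'" "nulls_atoms F' \<subseteq> {..<M}"
  shows "\<exists>G\<in>set (successors Rs M F). set G = F'"
proof -
  obtain \<tau> Out where step: "\<tau> \<in> active_triggers (set Rs) (set F)" "is_output \<tau> (set F) Out" "F' = set F \<union> Out"
    using assms(2) unfolding chase_step_def by blast
  obtain R s where \<tau>: "\<tau> = (R, map_of s)" "(R, s) \<in> set (active_list Rs F)"
    using step(1) unfolding active_triggers_list[OF assms(1)] by auto
  have s: "map fst s = univ_list R" using \<tau>(2) by (auto simp: mem_active_list)
  obtain \<sigma>' \<nu> where o: "extension_to_exis (R, map_of s) \<sigma>'" "inj_on \<nu> (exis_vars R)"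
    "\<And>z. z \<in> exis_vars R \<Longrightarrow> \<sigma>' z = Some (Null (\<nu> z)) \<and> \<nu> z \<notin> nulls_atoms (set F)"
    "Out = apply_atom \<sigma>' ` set (head R)"
    using step(2) unfolding is_output_def \<tau>(1) by auto
  let ?e = "map (\<lambda>v. (v, the (\<sigma>' v))) (exis_list R)"
  have e: "map snd ?e = map (\<lambda>v. Null (\<nu> v)) (exis_list R)"
    using o(3) by (simp add: set_exis_list)
  have "\<nu> z < M" if z: "z \<in> exis_vars R" for z
  proof -
    obtain a where a: "a \<in> set (head R)" "Var z \<in> set (args a)"
      using z unfolding exis_vars_def vars_atoms_def by blast
    have "Null (\<nu> z) \<in> set (args (apply_atom \<sigma>' a))"
      using o(3)[OF z] by (intro term_of_applied_atom[OF a(2)]) simp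
    then have "\<nu> z \<in> nulls_atoms F'" using a(1) by (auto simp: step(3) o(4) nulls_atoms_def)
    then show ?thesis using assms(3) by auto
  qed
  then have e1: "snd ` set ?e \<subseteq> Null ` {0..<M}"
    unfolding set_map[symmetric] e by (auto simp: set_exis_list)
  have e2: "distinct (map snd ?e)"
    unfolding e using o(2) by (auto simp: distinct_map distinct_exis_list set_exis_list inj_on_def)
  have e3: "\<forall>t\<in>snd ` set ?e. t \<notin> set (trms F)"
    unfolding set_map[symmetric] e using o(3) by (auto simp: set_exis_list Null_mem_trms)
  have e4: "map fst ?e = exis_list R" by (simp add: comp_def)
  have "F @ map (apply_atom (map_of (?e @ s))) (head R) \<in> set (successors Rs M F)"
    unfolding mem_successors by (intro exI conjI) (rule \<tau>(2) e4 e1 e2 e3 refl)+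
  then show ?thesis
    by (rule rev_bexI) (simp only: extension_to_exis_map_of[OF o(1) s], simp add: step(3) o(4))
qed

section \<open>Breadth-first sequences\<close>

text \<open>The entries up to index \<open>N\<close> decide exactly the deadlines that are at most
  \<open>N\<close>; later deadlines are left open. Imposing this for all \<open>N\<close> imposes
  every deadline.\<close>

definition fair_upto :: "ex_rule set \<Rightarrow> (nat \<Rightarrow> atom set) \<Rightarrow> nat \<Rightarrow> bool" where
  "fair_upto \<Sigma> F N \<longleftrightarrow> (\<forall>i. i + card (active_triggers \<Sigma> (F i)) \<le> N \<longrightarrow>
     (\<forall>\<tau>\<in>active_triggers \<Sigma> (F i). obsolete \<tau> (F (i + card (active_triggers \<Sigma> (F i))))))"

lemma obsolete_mono: "obsolete \<tau> F \<Longrightarrow> F \<subseteq> G \<Longrightarrow> obsolete \<tau> G"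
  unfolding obsolete_def by blast

lemma chase_step_mono: "chase_step \<Sigma> F G \<Longrightarrow> F \<subseteq> G"
  unfolding chase_step_def by blast

lemma breadth_first_infinite_iff:
  "breadth_first K F \<infinity> \<longleftrightarrow> chase_derivation K F \<infinity> \<and> (\<forall>N. fair_upto (fst K) F N)"
proof (cases "chase_derivation K F \<infinity>")
  case True
  let ?n = "\<lambda>i. card (active_triggers (fst K) (F i))"
  have mono: "F i \<subseteq> F j" if "i \<le> j" for i j
    using that
  proof (rule lift_Suc_mono_le[of F, rotated])
    fix k
    have "chase_step (fst K) (F k) (F (Suc k))" using True unfolding chase_derivation_def by simp
    then show "F k \<subseteq> F (Suc k)" by (rule chase_step_mono)
  qed
  have "(\<forall>\<tau>\<in>triggers (fst K). loaded \<tau> (F i) \<longrightarrow> (\<exists>j\<in>{i..i + ?n i}. obsolete \<tau> (F j))) \<longleftrightarrow>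
      (\<forall>\<tau>\<in>active_triggers (fst K) (F i). obsolete \<tau> (F (i + ?n i)))" for i
  proof -
    have eq: "(\<exists>j\<in>{i..i + ?n i}. obsolete \<tau> (F j)) \<longleftrightarrow> obsolete \<tau> (F (i + ?n i))" for \<tau>
    proof
      assume "\<exists>j\<in>{i..i + ?n i}. obsolete \<tau> (F j)"
      then obtain j where "j \<le> i + ?n i" "obsolete \<tau> (F j)" by auto
      then show "obsolete \<tau> (F (i + ?n i))" using obsolete_mono mono by blast
    qed auto
    \<comment> \<open>A loaded trigger that is already obsolete stays so and meets its deadline,
      which leaves only the active ones.\<close>
    have up: "obsolete \<tau> (F (i + ?n i))" if "obsolete \<tau> (F i)" for \<tau>
      using that obsolete_mono mono le_add1 by blast
    have "\<tau> \<in> active_triggers (fst K) (F i) \<longleftrightarrow>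
        \<tau> \<in> triggers (fst K) \<and> loaded \<tau> (F i) \<and> \<not> obsolete \<tau> (F i)" for \<tau>
      by (simp add: active_triggers_def)
    then show ?thesis unfolding eq using up by blast
  qed
  moreover have "(\<forall>N. fair_upto (fst K) F N) \<longleftrightarrow>
      (\<forall>i. \<forall>\<tau>\<in>active_triggers (fst K) (F i). obsolete \<tau> (F (i + ?n i)))"
    unfolding fair_upto_def by blast
  ultimately show ?thesis using True unfolding breadth_first_def by simp
qed (simp add: breadth_first_def)

lemma finite_vars_atoms: "finite A \<Longrightarrow> finite (vars_atoms A)"
proof -
  assume fin: "finite A"
  have "vars_atoms A \<subseteq> (\<Union>a\<in>A. (\<lambda>t. case t of Var v \<Rightarrow> v | _ \<Rightarrow> 0) ` set (args a))"
    unfolding vars_atoms_def by (force simp: image_iff split: trm.splits)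
  then show ?thesis by (rule finite_subset) (simp add: fin)
qed

lemma finite_exis_vars: "finite (exis_vars R)"
  by (simp add: exis_vars_def finite_vars_atoms)

lemma chase_step_facts:
  assumes "\<forall>a\<in>F. is_fact a" "chase_step \<Sigma> F G"
  shows "\<forall>a\<in>G. is_fact a"
proof -
  obtain \<tau> Out where \<tau>: "is_output \<tau> F Out" "G = F \<union> Out"
    using assms(2) unfolding chase_step_def by blast
  obtain R \<sigma> where "\<tau> = (R, \<sigma>)" by force
  then obtain \<sigma>' where s: "extension_to_exis (R, \<sigma>) \<sigma>'" "G = F \<union> apply_atom \<sigma>' ` set (head R)"
    using \<tau> unfolding is_output_def by auto
  have "var_free (apply_trm \<sigma>' t)" if "a \<in> set (head R)" "t \<in> set (args a)" for a t
  proof (cases t)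
    case (Var v)
    then have "v \<in> univ_vars R \<union> exis_vars R"
      using that by (auto simp: exis_vars_def vars_atoms_def)
    then obtain u where "\<sigma>' v = Some u"
      using s(1) by (auto simp: extension_to_exis_def substitution_on_def)
    then show ?thesis using Var s(1)
      by (auto simp: extension_to_exis_def substitution_on_def intro: ranI)
  qed auto
  then show ?thesis using assms(1) s(2) by (auto simp: is_fact_def apply_atom_def)
qed

text \<open>Rules contain no nulls, and universal variables take values among the terms of
  \<open>F\<close> by \<open>ran_loaded\<close>. New nulls can only be values of the existential
  variables of the rule applied, which bounds their number.\<close>

lemma chase_step_nulls:
  assumes "\<forall>R\<in>\<Sigma>. existential_rule R" "chase_step \<Sigma> F G"
  shows "\<exists>R\<in>\<Sigma>. \<exists>\<nu>. nulls_atoms G \<subseteq> nulls_atoms F \<union> \<nu> ` exis_vars R"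
proof -
  obtain R \<sigma> Out where act: "(R, \<sigma>) \<in> active_triggers \<Sigma> F" "is_output (R, \<sigma>) F Out" "G = F \<union> Out"
    using assms(2) unfolding chase_step_def by fast
  obtain \<sigma>' \<nu> where o: "extension_to_exis (R, \<sigma>) \<sigma>'"
    "\<forall>z\<in>exis_vars R. \<sigma>' z = Some (Null (\<nu> z))" "Out = apply_atom \<sigma>' ` set (head R)"
    using act(2) unfolding is_output_def by auto
  have R: "R \<in> \<Sigma>" "dom \<sigma> = univ_vars R" "loaded (R, \<sigma>) F"
    using act(1) by (auto simp: active_triggers_def triggers_def substitution_on_def)
  have "n \<in> nulls_atoms F \<union> \<nu> ` exis_vars R"
    if n: "apply_trm \<sigma>' t = Null n" "t \<in> set (args a)" "a \<in> set (head R)" for n t a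
  proof (cases t)
    case (Var v)
    show ?thesis
    proof (cases "v \<in> univ_vars R")
      case True
      then obtain u where u: "\<sigma> v = Some u" using R(2) by blast
      then have "\<sigma>' v = Some u"
        using o(1) by (auto simp: extension_to_exis_def map_le_def dom_def)
      then have "Null n \<in> ran \<sigma>" using u n(1) Var by (auto intro: ranI)
      then show ?thesis using ran_loaded[OF R(2,3)] by (auto simp: nulls_atoms_def)
    next
      case False
      then have "v \<in> exis_vars R" using n Var by (auto simp: exis_vars_def vars_atoms_def)
      then show ?thesis using o(2) n(1) Var by auto
    qed
  next
    case (Null m)
    have "null_free_atom a" using assms(1) R(1) n(3) unfolding existential_rule_def by blast
    then show ?thesis using n(2) Null by (auto simp: null_free_atom_def)
  qed (use n in auto)
  note * = this
  have "nulls_atoms G \<subseteq> nulls_atoms F \<union> \<nu> ` exis_vars R"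
  proof
    fix n assume "n \<in> nulls_atoms G"
    then obtain a where a: "a \<in> F \<union> Out" "Null n \<in> set (args a)"
      by (auto simp: nulls_atoms_def act(3))
    show "n \<in> nulls_atoms F \<union> \<nu> ` exis_vars R"
    proof (cases "a \<in> F")
      case True
      then show ?thesis using a(2) by (auto simp: nulls_atoms_def)
    next
      case False
      then obtain b where b: "b \<in> set (head R)" "a = apply_atom \<sigma>' b" using a(1) o(3) by auto
      obtain t where "t \<in> set (args b)" "apply_trm \<sigma>' t = Null n"
        using a(2) unfolding b(2) apply_atom_def by auto
      then show ?thesis using * b(1) by blast
    qed
  qed
  then show ?thesis using R(1) by blast
qed


section \<open>Renaming nulls\<close>

fun rename_trm :: "(nat \<Rightarrow> nat) \<Rightarrow> trm \<Rightarrow> trm" where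
  "rename_trm \<pi> (Null n) = Null (\<pi> n)"
| "rename_trm \<pi> t = t"

definition rename_atom :: "(nat \<Rightarrow> nat) \<Rightarrow> atom \<Rightarrow> atom" where
  "rename_atom \<pi> a = Atom (pname a) (map (rename_trm \<pi>) (args a))"

definition rename_subst :: "(nat \<Rightarrow> nat) \<Rightarrow> substitution \<Rightarrow> substitution" where
  "rename_subst \<pi> \<sigma> = (\<lambda>v. map_option (rename_trm \<pi>) (\<sigma> v))"

definition rename_trigger :: "(nat \<Rightarrow> nat) \<Rightarrow> trigger \<Rightarrow> trigger" where
  "rename_trigger \<pi> = map_prod id (rename_subst \<pi>)"

lemma rename_trm_inverse: "\<rho> \<circ> \<pi> = id \<Longrightarrow> rename_trm \<rho> (rename_trm \<pi> t) = t"
  by (cases t) (auto simp: pointfree_idE)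

lemma rename_atom_inverse: "\<rho> \<circ> \<pi> = id \<Longrightarrow> rename_atom \<rho> (rename_atom \<pi> a) = a"
  by (cases a) (simp add: rename_atom_def rename_trm_inverse comp_def)

lemma rename_atom_image_inverse: "\<rho> \<circ> \<pi> = id \<Longrightarrow> rename_atom \<rho> ` rename_atom \<pi> ` F = F"
  by (simp add: image_image rename_atom_inverse)

lemma rename_trigger_inverse: "\<rho> \<circ> \<pi> = id \<Longrightarrow> rename_trigger \<rho> (rename_trigger \<pi> \<tau>) = \<tau>"
  by (cases \<tau>)
    (simp add: rename_trigger_def rename_subst_def option.map_comp comp_def rename_trm_inverse option.map_ident)

lemma var_free_rename_trm [simp]: "var_free (rename_trm \<pi> t) \<longleftrightarrow> var_free t"
  by (cases t) auto

lemma dom_rename_subst [simp]: "dom (rename_subst \<pi> \<sigma>) = dom \<sigma>"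
  by (auto simp: rename_subst_def dom_def)

lemma substitution_on_rename: "substitution_on V \<sigma> \<Longrightarrow> substitution_on V (rename_subst \<pi> \<sigma>)"
  unfolding substitution_on_def by (auto simp: ran_def rename_subst_def)

text \<open>A null in \<open>a\<close> itself would be renamed on the right but not on the left;
  this is where rules without nulls matter.\<close>

lemma apply_atom_rename:
  assumes "null_free_atom a"
  shows "apply_atom (rename_subst \<pi> \<sigma>) a = rename_atom \<pi> (apply_atom \<sigma> a)"
proof -
  have "apply_trm (rename_subst \<pi> \<sigma>) t = rename_trm \<pi> (apply_trm \<sigma> t)" if "null_free t" for t
    using that by (cases t) (auto simp: rename_subst_def split: option.splits)
  then show ?thesis using assms by (simp add: apply_atom_def rename_atom_def null_free_atom_def)
qed

lemma loaded_rename: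
  assumes "existential_rule (fst \<tau>)" "loaded \<tau> F"
  shows "loaded (rename_trigger \<pi> \<tau>) (rename_atom \<pi> ` F)"
  using assms
  by (cases \<tau>) (auto simp: loaded_def rename_trigger_def existential_rule_def apply_atom_rename)

lemma extension_to_exis_rename:
  "extension_to_exis \<tau> \<sigma>' \<Longrightarrow> extension_to_exis (rename_trigger \<pi> \<tau>) (rename_subst \<pi> \<sigma>')"
proof (cases \<tau>)
  case (Pair R \<sigma>)
  moreover assume "extension_to_exis \<tau> \<sigma>'"
  moreover have "rename_subst \<pi> \<sigma> \<subseteq>\<^sub>m rename_subst \<pi> \<sigma>'" if "\<sigma> \<subseteq>\<^sub>m \<sigma>'"
    using that unfolding map_le_def dom_rename_subst by (simp add: rename_subst_def)
  ultimately show ?thesis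
    by (simp add: extension_to_exis_def rename_trigger_def substitution_on_rename)
qed

lemma apply_head_rename:
  assumes "existential_rule R"
  shows "apply_atom (rename_subst \<pi> \<sigma>) ` set (head R) = rename_atom \<pi> ` apply_atom \<sigma> ` set (head R)"
  unfolding image_image using assms
  by (intro image_cong) (auto simp: existential_rule_def apply_atom_rename)

lemma fst_rename_trigger [simp]: "fst (rename_trigger \<pi> \<tau>) = fst \<tau>"
  by (simp add: rename_trigger_def)

lemma obsolete_rename:
  assumes "existential_rule (fst \<tau>)" "obsolete \<tau> F"
  shows "obsolete (rename_trigger \<pi> \<tau>) (rename_atom \<pi> ` F)"
proof -
  obtain \<sigma>' where \<sigma>': "extension_to_exis \<tau> \<sigma>'" "apply_atom \<sigma>' ` set (head (fst \<tau>)) \<subseteq> F"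
    using assms(2) unfolding obsolete_def by blast
  then have "apply_atom (rename_subst \<pi> \<sigma>') ` set (head (fst \<tau>)) \<subseteq> rename_atom \<pi> ` F"
    unfolding apply_head_rename[OF assms(1)] by (intro image_mono)
  then show ?thesis
    using extension_to_exis_rename[OF \<sigma>'(1), of \<pi>] unfolding obsolete_def fst_rename_trigger by blast
qed

text \<open>Loadedness and obsolescence are preserved by every renaming. Non-obsolescence is
  obtained by applying the inverse permutation to a match in the renamed facts.\<close>

lemma active_triggers_rename_mem:
  assumes "\<forall>R\<in>\<Sigma>. existential_rule R" "bij \<pi>" "\<tau> \<in> active_triggers \<Sigma> F"
  shows "rename_trigger \<pi> \<tau> \<in> active_triggers \<Sigma> (rename_atom \<pi> ` F)"
proof -
  have inv: "inv \<pi> \<circ> \<pi> = id" using assms(2) by (simp add: bij_is_inj)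
  have \<tau>: "\<tau> \<in> triggers \<Sigma>" "loaded \<tau> F" "\<not> obsolete \<tau> F"
    using assms(3) by (auto simp: active_triggers_def)
  then have ex: "existential_rule (fst \<tau>)" using assms(1) by (auto simp: triggers_def)
  have "\<not> obsolete (rename_trigger \<pi> \<tau>) (rename_atom \<pi> ` F)"
    using obsolete_rename[of "rename_trigger \<pi> \<tau>" "rename_atom \<pi> ` F" "inv \<pi>"] ex \<tau>(3)
    by (auto simp: rename_atom_image_inverse[OF inv] rename_trigger_inverse[OF inv])
  moreover have "rename_trigger \<pi> \<tau> \<in> triggers \<Sigma>"
    using \<tau>(1) by (auto simp: triggers_def rename_trigger_def substitution_on_rename)
  ultimately show ?thesis using loaded_rename[OF ex \<tau>(2)] by (simp add: active_triggers_def)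
qed

lemma active_triggers_rename:
  assumes "\<forall>R\<in>\<Sigma>. existential_rule R" "bij \<pi>"
  shows "active_triggers \<Sigma> (rename_atom \<pi> ` F) = rename_trigger \<pi> ` active_triggers \<Sigma> F"
proof
  show "active_triggers \<Sigma> (rename_atom \<pi> ` F) \<subseteq> rename_trigger \<pi> ` active_triggers \<Sigma> F"
  proof
    fix \<tau> assume \<tau>: "\<tau> \<in> active_triggers \<Sigma> (rename_atom \<pi> ` F)"
    have inv: "inv \<pi> \<circ> \<pi> = id" "\<pi> \<circ> inv \<pi> = id"
      using assms(2) by (simp_all add: bij_is_inj bij_is_surj surj_iff[symmetric])
    from active_triggers_rename_mem[OF assms(1) bij_imp_bij_inv[OF assms(2)] \<tau>]
    have "rename_trigger (inv \<pi>) \<tau> \<in> active_triggers \<Sigma> F"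
      by (simp add: rename_atom_image_inverse[OF inv(1)])
    then show "\<tau> \<in> rename_trigger \<pi> ` active_triggers \<Sigma> F"
      using rename_trigger_inverse[OF inv(2), of \<tau>] by force
  qed
qed (auto intro: active_triggers_rename_mem[OF assms])

text \<open>The number of active triggers determines the deadlines in \<open>fair_upto\<close>, so
  these survive a permutation of the nulls.\<close>

lemma card_rename_trigger:
  assumes "bij \<pi>" shows "card (rename_trigger \<pi> ` T) = card T"
proof -
  have "inv \<pi> \<circ> \<pi> = id" using assms by (simp add: bij_is_inj)
  then have "inj (rename_trigger \<pi>)" by (metis injI rename_trigger_inverse)
  then show ?thesis by (auto intro: card_image inj_on_subset)
qed

lemma nulls_atoms_rename: "nulls_atoms (rename_atom \<pi> ` F) = \<pi> ` nulls_atoms F"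
proof -
  have "Null n \<in> rename_trm \<pi> ` T \<longleftrightarrow> (\<exists>m. n = \<pi> m \<and> Null m \<in> T)" for n T
  proof
    assume "Null n \<in> rename_trm \<pi> ` T"
    then obtain t where "t \<in> T" "Null n = rename_trm \<pi> t" by blast
    then show "\<exists>m. n = \<pi> m \<and> Null m \<in> T" by (cases t) auto
  qed (auto intro: image_eqI[where x = "Null _"])
  then show ?thesis by (auto simp: nulls_atoms_def rename_atom_def)
qed

lemma chase_step_rename:
  assumes "\<forall>R\<in>\<Sigma>. existential_rule R" "bij \<pi>" "chase_step \<Sigma> F G"
  shows "chase_step \<Sigma> (rename_atom \<pi> ` F) (rename_atom \<pi> ` G)"
proof -
  obtain \<tau> Out where \<tau>: "\<tau> \<in> active_triggers \<Sigma> F" "is_output \<tau> F Out" "G = F \<union> Out"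
    using assms(3) unfolding chase_step_def by blast
  have ex: "existential_rule (fst \<tau>)"
    using \<tau>(1) assms(1) by (auto simp: active_triggers_def triggers_def)
  obtain \<sigma>' \<nu> where o: "extension_to_exis \<tau> \<sigma>'" "inj_on \<nu> (exis_vars (fst \<tau>))"
    "\<forall>z\<in>exis_vars (fst \<tau>). \<sigma>' z = Some (Null (\<nu> z)) \<and> \<nu> z \<notin> nulls_atoms F"
    "Out = apply_atom \<sigma>' ` set (head (fst \<tau>))"
    using \<tau>(2) unfolding is_output_def by blast
  have inj: "inj \<pi>" using assms(2) by (rule bij_is_inj)
  have "is_output (rename_trigger \<pi> \<tau>) (rename_atom \<pi> ` F) (rename_atom \<pi> ` Out)"
    unfolding is_output_def fst_rename_trigger
  proof (intro exI conjI)
    show "inj_on (\<pi> \<circ> \<nu>) (exis_vars (fst \<tau>))"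
      using o(2) inj by (auto intro: comp_inj_on inj_on_subset)
    show "\<forall>z\<in>exis_vars (fst \<tau>). rename_subst \<pi> \<sigma>' z = Some (Null ((\<pi> \<circ> \<nu>) z)) \<and>
        (\<pi> \<circ> \<nu>) z \<notin> nulls_atoms (rename_atom \<pi> ` F)"
      using o(3) inj by (auto simp: rename_subst_def nulls_atoms_rename inj_image_mem_iff)
    show "rename_atom \<pi> ` Out = apply_atom (rename_subst \<pi> \<sigma>') ` set (head (fst \<tau>))"
      by (simp add: o(4) apply_head_rename[OF ex])
  qed (rule extension_to_exis_rename[OF o(1)])
  then show ?thesis
    unfolding chase_step_def \<tau>(3) image_Un
    using active_triggers_rename_mem[OF assms(1,2) \<tau>(1)] by (intro bexI exI conjI) (assumption | rule refl)+
qed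

lemma fair_upto_rename:
  assumes "\<forall>R\<in>\<Sigma>. existential_rule R" "bij \<pi>" "fair_upto \<Sigma> F N"
  shows "fair_upto \<Sigma> (\<lambda>i. rename_atom \<pi> ` F i) N"
  unfolding fair_upto_def active_triggers_rename[OF assms(1,2)] card_rename_trigger[OF assms(2)]
proof (intro allI impI ballI)
  fix i \<tau> assume i: "i + card (active_triggers \<Sigma> (F i)) \<le> N"
    and "\<tau> \<in> rename_trigger \<pi> ` active_triggers \<Sigma> (F i)"
  then obtain \<tau>' where \<tau>': "\<tau>' \<in> active_triggers \<Sigma> (F i)" "\<tau> = rename_trigger \<pi> \<tau>'" by blast
  moreover have "existential_rule (fst \<tau>')"
    using \<tau>'(1) assms(1) by (auto simp: active_triggers_def triggers_def)
  ultimately show "obsolete \<tau> (rename_atom \<pi> ` F (i + card (active_triggers \<Sigma> (F i))))"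
    using i assms(3) unfolding fair_upto_def by (auto intro: obsolete_rename)
qed

text \<open>For a new point \<open>x\<close>, swapping \<open>p x\<close> and \<open>f x\<close>
  corrects the value there. By injectivity of \<open>p\<close> and \<open>f\<close> neither of them
  is a value on \<open>A\<close>, so earlier corrections remain.\<close>

lemma inj_on_extend_bij:
  fixes f :: "'a \<Rightarrow> 'a"
  assumes "finite A" "inj_on f A"
  shows "\<exists>p. bij p \<and> (\<forall>x\<in>A. p x = f x)"
  using assms
proof (induction A rule: finite_induct)
  case empty
  show ?case by (intro exI[of _ id] conjI bij_id) simp
next
  case (insert x A)
  then obtain p where p: "bij p" "\<forall>y\<in>A. p y = f y" by auto
  let ?q = "transpose (p x) (f x) \<circ> p"
  have "?q y = f y" if "y \<in> A" for y
  proof -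
    have "p y \<noteq> p x" using p(1) that insert.hyps by (metis bij_pointE)
    moreover have "p y \<noteq> f x" using inj_onD[OF insert.prems, of y x] p(2) that insert.hyps by auto
    ultimately show ?thesis using p(2) that by (simp add: transpose_def)
  qed
  moreover have "bij ?q" using p(1) by (simp add: bij_comp)
  ultimately show ?case by (intro exI[of _ ?q] conjI ballI) (assumption | auto)+
qed

lemma bij_into_initial_segments:
  fixes A :: "nat \<Rightarrow> nat set"
  assumes "\<And>i. finite (A i)" "\<And>i. A i \<subseteq> A (Suc i)" "\<And>i. card (A i) \<le> i * k"
  shows "\<exists>\<pi>. bij \<pi> \<and> (\<forall>i\<le>N. \<pi> ` A i \<subseteq> {..<i * k})"
proof (induction N)
  case 0
  have "A 0 = {}" using assms(1,3)[of 0] by simp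
  then show ?case using bij_id by auto
next
  case (Suc N)
  then obtain \<pi> where \<pi>: "bij \<pi>" "\<forall>i\<le>N. \<pi> ` A i \<subseteq> {..<i * k}" by blast
  have mono: "i \<le> j \<Longrightarrow> A i \<subseteq> A j" for i j using assms(2) by (rule lift_Suc_mono_le)
  let ?B = "A (Suc N) - A N" and ?C = "{..<Suc N * k} - \<pi> ` A N"
  have inj: "inj_on \<pi> (A N)" using \<pi>(1) by (meson bij_is_inj inj_on_subset subset_UNIV)
  have sub: "\<pi> ` A N \<subseteq> {..<Suc N * k}" using \<pi>(2) by fastforce
  have "card ?B = card (A (Suc N)) - card (A N)" using assms(1,2) by (simp add: card_Diff_subset)
  moreover have "card ?C = Suc N * k - card (A N)"
    using sub assms(1) by (simp add: card_Diff_subset card_image[OF inj])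
  ultimately have "card ?B \<le> card ?C" using assms(3)[of "Suc N"] by linarith
  then obtain g where g: "g ` ?B \<subseteq> ?C" "inj_on g ?B"
    using card_le_inj[of ?B ?C] assms(1) by auto
  define f where "f x = (if x \<in> A N then \<pi> x else g x)" for x
  have "inj_on f (A (Suc N))"
  proof (rule inj_onI)
    fix x y assume xy: "x \<in> A (Suc N)" "y \<in> A (Suc N)" "f x = f y"
    show "x = y"
    proof (cases "x \<in> A N"; cases "y \<in> A N")
      assume "x \<in> A N" "y \<in> A N"
      then show ?thesis using xy(3) inj by (simp add: f_def inj_on_eq_iff)
    next
      assume "x \<in> A N" "y \<notin> A N"
      moreover from this have "g y \<in> ?C" using g(1) xy(2) by blast
      ultimately show ?thesis using xy(3) by (force simp: f_def)
    next
      assume "x \<notin> A N" "y \<in> A N"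
      moreover from this have "g x \<in> ?C" using g(1) xy(1) by blast
      ultimately show ?thesis using xy(3) by (force simp: f_def)
    next
      assume "x \<notin> A N" "y \<notin> A N"
      then show ?thesis using xy inj_onD[OF g(2), of x y] by (simp add: f_def)
    qed
  qed
  from inj_on_extend_bij[OF assms(1) this] obtain \<rho> where \<rho>: "bij \<rho>" "\<forall>x\<in>A (Suc N). \<rho> x = f x" by blast
  have "\<rho> ` A i \<subseteq> {..<i * k}" if "i \<le> Suc N" for i
  proof (cases "i = Suc N")
    case True
    have "f ` A (Suc N) \<subseteq> {..<Suc N * k}" using sub g(1) by (auto simp: f_def)
    then show ?thesis using True \<rho>(2) by auto
  next
    case False
    then have "i \<le> N" using that by simp
    then have "A i \<subseteq> A N" "A i \<subseteq> A (Suc N)" using mono by auto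
    then have "\<rho> ` A i = \<pi> ` A i" using \<rho>(2) by (intro image_cong) (auto simp: f_def subset_iff)
    then show ?thesis using \<pi>(2) \<open>i \<le> N\<close> by auto
  qed
  then show ?case using \<rho>(1) by blast
qed

section \<open>Compactness\<close>

text \<open>A prefix is \<open>good\<close> if it continues to paths of every length. The start is
  good, a good prefix has a good extension by one entry, and dependent choice yields the infinite
  path. The property \<open>P N\<close> looks only at entries up to \<open>N\<close> and passes to
  shorter prefixes.\<close>

lemma koenig_infinite_path:
  fixes S :: "nat \<Rightarrow> 'a \<Rightarrow> 'a set"
  assumes fin: "\<And>i x. finite (S i x)"
    and P_cong: "\<And>N g h. P N g \<Longrightarrow> \<forall>i\<le>N. g i = h i \<Longrightarrow> P N h"
    and P_mono: "\<And>N g. P (Suc N) g \<Longrightarrow> P N g"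
    and ex: "\<And>N. \<exists>g. g 0 = d \<and> (\<forall>i<N. g (Suc i) \<in> S i (g i)) \<and> P N g"
  shows "\<exists>g. g 0 = d \<and> (\<forall>i. g (Suc i) \<in> S i (g i)) \<and> (\<forall>N. P N g)"
proof -
  define path where "path N g \<longleftrightarrow> g 0 = d \<and> (\<forall>i<N. g (Suc i) \<in> S i (g i)) \<and> P N g" for N g
  define good where "good n h \<longleftrightarrow> (\<forall>N\<ge>n. \<exists>g. path N g \<and> (\<forall>i\<le>n. g i = h i))" for n h
  have P_antimono: "P N g" if "N \<le> M" "P M g" for N M g
    using that by (induction rule: dec_induct) (auto dest: P_mono)
  have path_antimono: "path N g" if "N \<le> M" "path M g" for N M g
    using that P_antimono unfolding path_def by (meson order_less_le_trans)
  have good0: "good 0 (\<lambda>_. d)"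
    unfolding good_def
  proof (intro allI impI)
    fix N
    obtain g where "path N g" using ex[of N] unfolding path_def by blast
    then show "\<exists>g. path N g \<and> (\<forall>i\<le>0. g i = d)" by (auto simp: path_def)
  qed
  have step: "\<exists>h'. good (Suc n) h' \<and> (\<forall>i\<le>n. h' i = h i)" if "good n h" for n h
  proof -
    have "\<forall>N\<in>{Suc n..}. \<exists>g. path N g \<and> (\<forall>i\<le>n. g i = h i)" using that unfolding good_def by simp
    then obtain G where G: "\<And>N. N \<ge> Suc n \<Longrightarrow> path N (G N) \<and> (\<forall>i\<le>n. G N i = h i)"
      by (metis atLeast_iff)
    have "G N (Suc n) \<in> S n (h n)" if "N \<ge> Suc n" for N
      using G[OF that] that unfolding path_def by (metis Suc_le_lessD le_refl)
    then have "(\<lambda>N. G N (Suc n)) ` {Suc n..} \<subseteq> S n (h n)" by auto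
    then have "finite ((\<lambda>N. G N (Suc n)) ` {Suc n..})" using fin finite_subset by blast
    \<comment> \<open>Infinitely many of the chosen paths \<open>G N\<close> agree at
      \<open>Suc n\<close>. Their lengths are unbounded, so cutting them off gives continuations of
      every length.\<close>
    from pigeonhole_infinite[OF infinite_Ici this] obtain M where
      inf: "infinite {N \<in> {Suc n..}. G N (Suc n) = G M (Suc n)}" by blast
    define h' where "h' = h(Suc n := G M (Suc n))"
    have "good (Suc n) h'"
      unfolding good_def
    proof (intro allI impI)
      fix N
      obtain N' where N': "N' \<ge> N" "N' \<ge> Suc n" "G N' (Suc n) = G M (Suc n)"
        using inf unfolding infinite_nat_iff_unbounded_le by auto
      have "path N (G N')" using path_antimono[OF N'(1)] G[OF N'(2)] by blast
      moreover have "\<forall>i\<le>Suc n. G N' i = h' i"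
        using G[OF N'(2)] N'(3) by (auto simp: h'_def le_Suc_eq)
      ultimately show "\<exists>g. path N g \<and> (\<forall>i\<le>Suc n. g i = h' i)" by blast
    qed
    then show ?thesis by (intro exI[of _ h']) (auto simp: h'_def)
  qed
  obtain H where H: "\<And>n. good n (H n)" "\<And>n i. i \<le> n \<Longrightarrow> H (Suc n) i = H n i"
    using dependent_nat_choice[of good "\<lambda>n h h'. \<forall>i\<le>n. h' i = h i"] good0 step by metis
  \<comment> \<open>The prefixes \<open>H n\<close> extend one another, so the diagonal is their
    limit.\<close>
  define g where "g n = H n n" for n
  have agree: "H m i = g i" if "i \<le> m" for i m
    using that by (induction rule: dec_induct) (auto simp: g_def H(2))
  have "path N g" for N
  proof -
    obtain k where k: "path N k" "\<forall>i\<le>N. k i = H N i" using H(1)[of N] unfolding good_def by blast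
    then have eq: "\<forall>i\<le>N. k i = g i" using agree by simp
    show ?thesis
      unfolding path_def
    proof (intro conjI allI impI)
      show "g 0 = d" using k(1) eq unfolding path_def by simp
      show "P N g" using P_cong[of N k g] k(1) eq unfolding path_def by blast
      fix i assume "i < N"
      then show "g (Suc i) \<in> S i (g i)" using k(1) eq unfolding path_def by (metis Suc_leI less_imp_le)
    qed
  qed
  then show ?thesis unfolding path_def by blast
qed

text \<open>One step applies one rule, so the number of existential variables of all rules together
  is a crude bound on the nulls that a step invents.\<close>

definition exis_bound :: "ex_rule list \<Rightarrow> nat" where
  "exis_bound Rs = length (concat (map exis_list Rs))"

text \<open>Up to renaming, the nulls after \<open>i\<close> steps can be taken below \<open>i * exis_bound Rs\<close>,
  which makes the tree of chase derivations finitely branching.\<close>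

definition list_chase :: "ex_rule list \<Rightarrow> atom list \<Rightarrow> (nat \<Rightarrow> atom list) \<Rightarrow> nat \<Rightarrow> bool" where
  "list_chase Rs D g N \<longleftrightarrow>
     g 0 = D \<and> (\<forall>i<N. g (Suc i) \<in> set (successors Rs (Suc i * exis_bound Rs) (g i)))"

definition fair_list :: "ex_rule list \<Rightarrow> (nat \<Rightarrow> atom list) \<Rightarrow> nat \<Rightarrow> bool" where
  "fair_list Rs g N \<longleftrightarrow> (\<forall>i. i + length (active_list Rs (g i)) \<le> N \<longrightarrow>
     (\<forall>\<tau>\<in>set (active_list Rs (g i)).
       obsolete_list (g (i + length (active_list Rs (g i)))) (fst \<tau>) (snd \<tau>)))"

lemma card_exis_vars_le: "R \<in> set Rs \<Longrightarrow> card (exis_vars R) \<le> exis_bound Rs"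
proof -
  assume "R \<in> set Rs"
  then have "length (exis_list R) \<le> exis_bound Rs"
    unfolding exis_bound_def by (induction Rs) auto
  then show ?thesis using distinct_card[OF distinct_exis_list, of R] by (simp add: set_exis_list)
qed

lemma fair_list_iff:
  assumes "\<forall>i\<le>N. \<forall>a\<in>set (g i). is_fact a"
  shows "fair_list Rs g N \<longleftrightarrow> fair_upto (set Rs) (\<lambda>i. set (g i)) N"
proof -
  let ?A = "\<lambda>i. active_list Rs (g i)"
  have *: "(\<forall>\<tau>\<in>set (?A i). obsolete_list (g (i + length (?A i))) (fst \<tau>) (snd \<tau>)) \<longleftrightarrow>
    (\<forall>\<tau>\<in>active_triggers (set Rs) (set (g i)).
       obsolete \<tau> (set (g (i + length (?A i)))))"
    if le: "i + length (?A i) \<le> N" for i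
  proof -
    have facts: "\<forall>a\<in>set (g i). is_fact a" "\<forall>a\<in>set (g (i + length (?A i))). is_fact a"
      using assms le by (meson add_leD1, blast)
    have "obsolete_list (g (i + length (?A i))) (fst \<tau>) (snd \<tau>) \<longleftrightarrow>
        obsolete (fst \<tau>, map_of (snd \<tau>)) (set (g (i + length (?A i))))"
      if "\<tau> \<in> set (?A i)" for \<tau>
    proof (rule obsolete_list_iff[OF facts(2)])
      have \<tau>: "(fst \<tau>, snd \<tau>) \<in> set (?A i)" using that by simp
      then show "map fst (snd \<tau>) = univ_list (fst \<tau>)" unfolding mem_active_list by simp
      have "snd ` set (snd \<tau>) \<subseteq> set (trms (g i))" using \<tau> unfolding mem_active_list by simp
      then show "\<forall>t\<in>snd ` set (snd \<tau>). var_free t" using facts(1) by (auto simp: set_trms is_fact_def)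
    qed
    then show ?thesis
      unfolding active_triggers_list[OF facts(1)] case_prod_beta ball_simps by (rule ball_cong[OF refl])
  qed
  show ?thesis unfolding fair_list_def fair_upto_def
  proof (intro iff_allI)
    fix i
    show "(i + length (?A i) \<le> N \<longrightarrow>
        (\<forall>\<tau>\<in>set (?A i). obsolete_list (g (i + length (?A i))) (fst \<tau>) (snd \<tau>))) \<longleftrightarrow>
      (i + card (active_triggers (set Rs) (set (g i))) \<le> N \<longrightarrow>
        (\<forall>\<tau>\<in>active_triggers (set Rs) (set (g i)).
          obsolete \<tau> (set (g (i + card (active_triggers (set Rs) (set (g i))))))))"
    \<comment> \<open>For \<open>i > N\<close> both sides are vacuous, whereas the lists there need
      not consist of facts and the two counts could differ.\<close>
    proof (cases "i \<le> N")
      case True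
      then have card: "card (active_triggers (set Rs) (set (g i))) = length (?A i)"
        using assms by (intro card_active_triggers_list) blast
      show ?thesis unfolding card using *[of i] by blast
    qed simp
  qed
qed

lemma list_chase_facts:
  assumes "\<forall>a\<in>set D. is_fact a" "list_chase Rs D g N" "i \<le> N"
  shows "\<forall>a\<in>set (g i). is_fact a"
  using assms(3)
proof (induction i)
  case 0
  then show ?case using assms(1,2) by (simp add: list_chase_def)
next
  case (Suc i)
  then have facts: "\<forall>a\<in>set (g i). is_fact a" by simp
  have "chase_step (set Rs) (set (g i)) (set (g (Suc i)))"
    using assms(2) Suc.prems unfolding list_chase_def by (metis Suc_le_lessD successors_chase_step[OF facts])
  then show ?case using chase_step_facts[OF facts] by blast
qed

lemma fair_upto_cong:
  assumes "fair_upto \<Sigma> F N" "\<And>i. i \<le> N \<Longrightarrow> F i = G i"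
  shows "fair_upto \<Sigma> G N"
  unfolding fair_upto_def
proof (intro allI impI)
  fix i assume i: "i + card (active_triggers \<Sigma> (G i)) \<le> N"
  have "F i = G i" "F (i + card (active_triggers \<Sigma> (G i))) = G (i + card (active_triggers \<Sigma> (G i)))"
    using i by (intro assms(2), linarith)+
  then show "\<forall>\<tau>\<in>active_triggers \<Sigma> (G i). obsolete \<tau> (G (i + card (active_triggers \<Sigma> (G i))))"
    using assms(1) i unfolding fair_upto_def by metis
qed

lemma bounded_list_chase:
  assumes "rule_set (set Rs)" "database (set D)"
    "chase_derivation (set Rs, set D) F \<infinity>" "\<forall>N. fair_upto (set Rs) F N"
  shows "\<exists>g. list_chase Rs D g N \<and> fair_list Rs g N"
proof -
  let ?E = "exis_bound Rs"
  have ex: "\<forall>R\<in>set Rs. existential_rule R" using assms(1) by (simp add: rule_set_def)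
  have F0: "F 0 = set D" and step: "chase_step (set Rs) (F i) (F (Suc i))" for i
    using assms(3) by (simp_all add: chase_derivation_def)
  have nD: "\<forall>a\<in>set D. is_fact a" "\<forall>a\<in>set D. null_free_atom a"
    using assms(2) by (auto simp: database_def)
  have card: "finite (nulls_atoms (F i)) \<and> card (nulls_atoms (F i)) \<le> i * ?E" for i
  proof (induction i)
    case 0
    have "nulls_atoms (F 0) = {}" using nD(2) by (force simp: F0 nulls_atoms_def null_free_atom_def)
    then show ?case by simp
  next
    case (Suc i)
    obtain R \<nu> where R: "R \<in> set Rs" "nulls_atoms (F (Suc i)) \<subseteq> nulls_atoms (F i) \<union> \<nu> ` exis_vars R"
      using chase_step_nulls[OF ex step] by blast
    have fin: "finite (nulls_atoms (F i) \<union> \<nu> ` exis_vars R)" using Suc finite_exis_vars by simp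
    have "card (nulls_atoms (F (Suc i))) \<le> card (nulls_atoms (F i)) + card (\<nu> ` exis_vars R)"
      using card_mono[OF fin R(2)] card_Un_le le_trans by blast
    moreover have "card (\<nu> ` exis_vars R) \<le> ?E"
      using card_image_le[OF finite_exis_vars] card_exis_vars_le[OF R(1)] le_trans by blast
    ultimately show ?case using Suc finite_subset[OF R(2) fin] by simp
  qed
  have sub: "nulls_atoms (F i) \<subseteq> nulls_atoms (F (Suc i))" for i
    using chase_step_mono[OF step[of i]] by (auto simp: nulls_atoms_def)
  obtain \<pi> where \<pi>: "bij \<pi>" "\<forall>i\<le>N. \<pi> ` nulls_atoms (F i) \<subseteq> {..<i * ?E}"
    using bij_into_initial_segments[of "\<lambda>i. nulls_atoms (F i)" ?E N] card sub by blast
  let ?F = "\<lambda>i. rename_atom \<pi> ` F i"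
  have step': "chase_step (set Rs) (?F i) (?F (Suc i))" for i
    by (rule chase_step_rename[OF ex \<pi>(1) step])
  have nulls: "nulls_atoms (?F i) \<subseteq> {..<i * ?E}" if "i \<le> N" for i
    using \<pi>(2) that by (simp add: nulls_atoms_rename)
  \<comment> \<open>The database has no nulls and is fixed by the renaming, so the renamed
    derivation still starts from it.\<close>
  have "rename_trm \<pi> t = t" if "null_free t" for t using that by (cases t) auto
  then have "rename_atom \<pi> a = a" if "a \<in> set D" for a
    using nD(2) that by (cases a) (auto simp: rename_atom_def null_free_atom_def intro: map_idI)
  then have F0': "?F 0 = set D" by (simp add: F0)
  have facts: "\<forall>a\<in>?F i. is_fact a" for i
  proof (induction i)
    case 0
    then show ?case unfolding F0' by (rule nD(1))
  next
    case (Suc i)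
    then show ?case by (rule chase_step_facts[OF _ step'])
  qed
  \<comment> \<open>The derivation only prescribes sets, but \<open>successors\<close> depends on
    the presenting list. The lists are therefore chosen recursively, each as a successor of the one
    chosen before.\<close>
  define next_list where
    "next_list i G = (SOME G'. G' \<in> set (successors Rs (Suc i * ?E) G) \<and> set G' = ?F (Suc i))" for i G
  have next_list: "next_list i G \<in> set (successors Rs (Suc i * ?E) G) \<and> set (next_list i G) = ?F (Suc i)"
    if "set G = ?F i" "i < N" for i G
  proof -
    have "\<exists>G'\<in>set (successors Rs (Suc i * ?E) G). set G' = ?F (Suc i)"
      using step'[of i] nulls[of "Suc i"] facts[of i] that by (intro chase_step_successors) simp_all
    then show ?thesis unfolding next_list_def Bex_def by (rule someI_ex)
  qed
  define g where "g = rec_nat D next_list"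
  have g_Suc: "g (Suc i) = next_list i (g i)" and g_0: "g 0 = D" for i by (simp_all add: g_def)
  have set_g: "set (g i) = ?F i" if "i \<le> N" for i
    using that
  proof (induction i)
    case (Suc i)
    then show ?case using next_list[of "g i" i] by (simp add: g_Suc)
  qed (simp only: g_0 F0')
  have "list_chase Rs D g N"
    unfolding list_chase_def g_Suc using next_list set_g g_0 by simp
  moreover have "fair_upto (set Rs) (\<lambda>i. set (g i)) N"
  proof -
    have "fair_upto (set Rs) ?F N" by (rule fair_upto_rename[OF ex \<pi>(1)]) (use assms(4) in blast)
    then show ?thesis by (rule fair_upto_cong) (simp add: set_g)
  qed
  ultimately show ?thesis using fair_list_iff[of N g Rs] facts set_g by auto
qed

text \<open>Renaming enters from left to right only, one prefix at a time. From right to left, the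
  path given by Koenig's lemma is a chase derivation as it stands, because \<open>successors\<close>
  is sound for any cap on the nulls.\<close>

lemma infinite_breadth_first_iff:
  assumes "rule_set (set Rs)" "database (set D)"
  shows "(\<exists>F. breadth_first (set Rs, set D) F \<infinity>) \<longleftrightarrow>
    (\<forall>N. \<exists>g. list_chase Rs D g N \<and> fair_list Rs g N)"
proof
  assume "\<exists>F. breadth_first (set Rs, set D) F \<infinity>"
  then show "\<forall>N. \<exists>g. list_chase Rs D g N \<and> fair_list Rs g N"
    using bounded_list_chase[OF assms] by (auto simp: breadth_first_infinite_iff)
next
  assume ex: "\<forall>N. \<exists>g. list_chase Rs D g N \<and> fair_list Rs g N"
  have "\<exists>g. g 0 = D \<and> (\<forall>i. g (Suc i) \<in> set (successors Rs (Suc i * exis_bound Rs) (g i))) \<and>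
      (\<forall>N. fair_list Rs g N)"
  proof (rule koenig_infinite_path)
    show "fair_list Rs h N" if "fair_list Rs g N" "\<forall>i\<le>N. g i = h i" for N g h
    proof -
      have "g i = h i" if "i + k \<le> N" for i k using that \<open>\<forall>i\<le>N. g i = h i\<close> by simp
      then show ?thesis using \<open>fair_list Rs g N\<close> \<open>\<forall>i\<le>N. g i = h i\<close> unfolding fair_list_def by metis
    qed
    show "fair_list Rs g N" if "fair_list Rs g (Suc N)" for N g
      using that unfolding fair_list_def by simp
  qed (use ex in \<open>auto simp: list_chase_def\<close>)
  then obtain g where g: "g 0 = D" "\<And>i. g (Suc i) \<in> set (successors Rs (Suc i * exis_bound Rs) (g i))"
    "\<And>N. fair_list Rs g N" by blast
  have lc: "list_chase Rs D g N" for N using g by (simp add: list_chase_def)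
  have nD: "\<forall>a\<in>set D. is_fact a" using assms(2) by (auto simp: database_def)
  have facts: "\<forall>a\<in>set (g i). is_fact a" for i using list_chase_facts[OF nD lc] by blast
  have "chase_step (set Rs) (set (g i)) (set (g (Suc i)))" for i
    using successors_chase_step[OF facts g(2)] .
  then have "breadth_first (set Rs, set D) (\<lambda>i. set (g i)) \<infinity>"
    unfolding breadth_first_infinite_iff chase_derivation_def
    using g(1,3) fair_list_iff facts by auto
  then show "\<exists>F. breadth_first (set Rs, set D) F \<infinity>" by blast
qed

section \<open>Deciding the existence of bounded chase derivations\<close>

text \<open>Paths are stored newest entry first, so \<open>hd p\<close> is the fact list to be
  extended; \<open>no_fair_path\<close> reverses them before testing.\<close>

definition paths :: "ex_rule list \<Rightarrow> atom list \<Rightarrow> nat \<Rightarrow> atom list list list" where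
  "paths Rs D N = rec_nat [[D]] (\<lambda>n P. concat (map (\<lambda>p. map (\<lambda>G. G # p)
     (successors Rs (Suc n * exis_bound Rs) (hd p))) P)) N"

text \<open>A path of \<open>N\<close> steps has \<open>N + 1\<close> entries, so
  \<open>< length q\<close> expresses the bound \<open>\<le> N\<close> of \<open>fair_list\<close>.
  It also keeps every access by \<open>hd\<close> and \<open>drop\<close> in range.\<close>

definition fair_path :: "ex_rule list \<Rightarrow> atom list list \<Rightarrow> bool" where
  "fair_path Rs q \<longleftrightarrow> (\<forall>i\<in>set [0..<length q]. let A = active_list Rs (hd (drop i q)) in
     i + length A < length q \<longrightarrow>
     (\<forall>\<tau>\<in>set A. obsolete_list (hd (drop (i + length A) q)) (fst \<tau>) (snd \<tau>)))"

definition no_fair_path :: "ex_rule list \<Rightarrow> atom list \<Rightarrow> nat \<Rightarrow> bool" where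
  "no_fair_path Rs D N \<longleftrightarrow> (\<forall>p\<in>set (paths Rs D N). \<not> fair_path Rs (rev p))"

text \<open>Every number will be the code of some rule list, so ill-formed input has to be rejected.
  The test uses \<open>case\<close> because \<open>computable_case_trm\<close> is stated for it; the
  same holds for \<open>database_ok\<close>.\<close>

definition rules_ok :: "ex_rule list \<Rightarrow> bool" where
  "rules_ok Rs \<longleftrightarrow> (\<forall>R\<in>set Rs. (\<forall>a\<in>set (body R @ head R). \<forall>t\<in>set (args a).
     case t of Var n \<Rightarrow> True | Const n \<Rightarrow> True | Null n \<Rightarrow> False) \<and> head R \<noteq> [])"

definition database_ok :: "atom list \<Rightarrow> bool" where
  "database_ok D \<longleftrightarrow> (\<forall>a\<in>set D. \<forall>t\<in>set (args a).
     case t of Var n \<Rightarrow> False | Const n \<Rightarrow> True | Null n \<Rightarrow> False)"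

lemma mem_paths:
  "p \<in> set (paths Rs D N) \<longleftrightarrow> (\<exists>g. list_chase Rs D g N \<and> p = map g (rev [0..<Suc N]))"
proof (induction N arbitrary: p)
  case 0
  show ?case by (auto simp: paths_def list_chase_def intro: exI[of _ "\<lambda>_. D"])
next
  case (Suc N)
  have "p \<in> set (paths Rs D (Suc N)) \<longleftrightarrow> (\<exists>p'. p' \<in> set (paths Rs D N) \<and>
      (\<exists>G\<in>set (successors Rs (Suc N * exis_bound Rs) (hd p')). p = G # p'))"
    unfolding paths_def by auto
  also have "\<dots> \<longleftrightarrow> (\<exists>g. list_chase Rs D g N \<and>
      (\<exists>G\<in>set (successors Rs (Suc N * exis_bound Rs) (g N)). p = G # map g (rev [0..<Suc N])))"
    unfolding Suc.IH by auto
  also have "\<dots> \<longleftrightarrow> (\<exists>g. list_chase Rs D g (Suc N) \<and> p = map g (rev [0..<Suc (Suc N)]))"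
  proof
    assume "\<exists>g. list_chase Rs D g N \<and>
      (\<exists>G\<in>set (successors Rs (Suc N * exis_bound Rs) (g N)). p = G # map g (rev [0..<Suc N]))"
    then obtain g G where g: "list_chase Rs D g N" "G \<in> set (successors Rs (Suc N * exis_bound Rs) (g N))"
      "p = G # map g (rev [0..<Suc N])" by blast
    let ?g = "g(Suc N := G)"
    have "list_chase Rs D ?g (Suc N)"
      using g(1,2) unfolding list_chase_def by (simp add: less_Suc_eq del: mult_Suc)
    moreover have "p = map ?g (rev [0..<Suc (Suc N)])" using g(3) by simp
    ultimately show "\<exists>g. list_chase Rs D g (Suc N) \<and> p = map g (rev [0..<Suc (Suc N)])" by blast
  next
    assume "\<exists>g. list_chase Rs D g (Suc N) \<and> p = map g (rev [0..<Suc (Suc N)])"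
    then obtain g where "list_chase Rs D g (Suc N)" "p = map g (rev [0..<Suc (Suc N)])" by blast
    then have "list_chase Rs D g N" "g (Suc N) \<in> set (successors Rs (Suc N * exis_bound Rs) (g N))"
      "p = g (Suc N) # map g (rev [0..<Suc N])"
      unfolding list_chase_def by (simp_all del: mult_Suc)
    then show "\<exists>g. list_chase Rs D g N \<and>
      (\<exists>G\<in>set (successors Rs (Suc N * exis_bound Rs) (g N)). p = G # map g (rev [0..<Suc N]))" by blast
  qed
  finally show ?case .
qed

lemma fair_path_iff: "fair_path Rs (map g [0..<Suc N]) \<longleftrightarrow> fair_list Rs g N"
proof -
  have nth: "hd (drop i (map g [0..<Suc N])) = g i" if "i < Suc N" for i
    using that by (subst hd_drop_conv_nth) (auto simp del: upt_Suc)
  have "fair_path Rs (map g [0..<Suc N]) \<longleftrightarrow> (\<forall>i<Suc N. i + length (active_list Rs (g i)) < Suc N \<longrightarrow>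
     (\<forall>\<tau>\<in>set (active_list Rs (g i)). obsolete_list (g (i + length (active_list Rs (g i)))) (fst \<tau>) (snd \<tau>)))"
    unfolding fair_path_def Let_def by (simp add: nth Ball_def del: upt_Suc)
  also have "\<dots> \<longleftrightarrow> fair_list Rs g N"
    unfolding fair_list_def less_Suc_eq_le by (meson add_leD1)
  finally show ?thesis .
qed

lemma no_fair_path_iff: "no_fair_path Rs D N \<longleftrightarrow> \<not> (\<exists>g. list_chase Rs D g N \<and> fair_list Rs g N)"
  unfolding no_fair_path_def Ball_def mem_paths by (auto simp: rev_map fair_path_iff simp del: upt_Suc)

lemma rules_ok_iff: "rules_ok Rs \<longleftrightarrow> rule_set (set Rs)"
proof -
  have "null_free t \<longleftrightarrow> (case t of Var n \<Rightarrow> True | Const n \<Rightarrow> True | Null n \<Rightarrow> False)" for t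
    by (cases t) auto
  then show ?thesis unfolding rules_ok_def rule_set_def existential_rule_def null_free_atom_def by simp
qed

lemma database_ok_iff: "database_ok D \<longleftrightarrow> database (set D)"
proof -
  have "var_free t \<and> null_free t \<longleftrightarrow> (case t of Var n \<Rightarrow> False | Const n \<Rightarrow> True | Null n \<Rightarrow> False)" for t
    by (cases t) auto
  then show ?thesis unfolding database_ok_def database_def is_fact_def null_free_atom_def by auto
qed

lemma CT_rest_bf_iff:
  "(set Rs, set D) \<in> CT_rest_bf \<longleftrightarrow> rules_ok Rs \<and> database_ok D \<and> (\<exists>N. no_fair_path Rs D N)"
proof -
  have "(\<forall>F L. breadth_first (set Rs, set D) F L \<longrightarrow> L \<noteq> \<infinity>) \<longleftrightarrow> \<not> (\<exists>F. breadth_first (set Rs, set D) F \<infinity>)"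
    by metis
  then show ?thesis
    unfolding CT_rest_bf_def knowledge_base_def rules_ok_iff database_ok_iff no_fair_path_iff
      mem_Collect_eq fst_conv snd_conv
    using infinite_breadth_first_iff[of Rs D] by blast
qed

text \<open>The condition on the rules is moved under both quantifiers to reach the form
  \<forall>\<exists> over one decidable relation. Lists that are no databases are satisfied by any
  \<open>N\<close>, and every database, being finite, is presented by a list.\<close>

lemma CT_rest_bf_rules_iff:
  "set Rs \<in> CT_rest_bf_rules \<longleftrightarrow>
     (\<forall>D. \<exists>N. rules_ok Rs \<and> (database_ok D \<longrightarrow> no_fair_path Rs D N))"
proof -
  have "(\<forall>D. database D \<longrightarrow> (set Rs, D) \<in> CT_rest_bf) \<longleftrightarrow>
      (\<forall>D. database (set D) \<longrightarrow> (set Rs, set D) \<in> CT_rest_bf)"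
    by (metis database_def finite_list)
  then show ?thesis
    unfolding CT_rest_bf_rules_def mem_Collect_eq CT_rest_bf_iff rules_ok_iff database_ok_iff by auto
qed


section \<open>Computability of the decision procedure\<close>

lemma computable_trms [computable_intros]: "computable f \<Longrightarrow> computable (\<lambda>x. trms (f x))"
  unfolding trms_def by (intro computable_intros)

lemma computable_var_list [computable_intros]: "computable f \<Longrightarrow> computable (\<lambda>x. var_list (f x))"
  unfolding var_list_def by (intro computable_intros)

lemma computable_univ_list [computable_intros]: "computable f \<Longrightarrow> computable (\<lambda>x. univ_list (f x))"
  unfolding univ_list_def by (intro computable_intros)

lemma computable_exis_list [computable_intros]: "computable f \<Longrightarrow> computable (\<lambda>x. exis_list (f x))"
proof -
  \<comment> \<open>The rule is proved for the plain argument and then composed: under the filter a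
    general argument would appear as \<open>f (fst p)\<close>, to which the assumption on
    \<open>f\<close> does not apply directly.\<close>
  have "computable (\<lambda>R. exis_list R)" unfolding exis_list_def by (intro computable_intros)
  then show "computable f \<Longrightarrow> computable (\<lambda>x. exis_list (f x))" by (rule computable_comp)
qed

lemma computable_substs [computable_intros]:
  assumes "computable f" "computable g" shows "computable (\<lambda>x. substs (f x) (g x))"
proof -
  have "computable (\<lambda>p. substs (fst p) (snd p))" unfolding substs_def by (intro computable_intros)
  from computable_compose2[OF this assms] show ?thesis .
qed

text \<open>The map \<open>map_of s\<close> is a function and has no code, so lookup is expressed as
  a fold over \<open>s\<close>. With \<open>foldr\<close> the first matching entry wins, as in
  \<open>map_of\<close>.\<close>

lemma apply_trm_map_of:
  "apply_trm (map_of s) t = (case t of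
     Var v \<Rightarrow> foldr (\<lambda>q u. if fst q = v then snd q else u) s (Var v) | Const n \<Rightarrow> t | Null n \<Rightarrow> t)"
proof (cases t)
  case (Var v)
  have "(case map_of s v of Some t \<Rightarrow> t | None \<Rightarrow> Var v) =
      foldr (\<lambda>q u. if fst q = v then snd q else u) s (Var v)"
    by (induction s) auto
  then show ?thesis using Var by simp
qed auto

lemma computable_apply_atom [computable_intros]:
  assumes "computable f" "computable g" shows "computable (\<lambda>x. apply_atom (map_of (f x)) (g x))"
proof -
  have "computable (\<lambda>p. apply_atom (map_of (fst p)) (snd p))"
    unfolding apply_atom_def apply_trm_map_of by (intro computable_intros)
  from computable_compose2[OF this assms] show ?thesis .
qed

lemma computable_loaded_list [computable_intros]:
  assumes "computable f" "computable g" "computable h"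
  shows "computable (\<lambda>x. loaded_list (f x) (g x) (h x))"
proof -
  have "computable (\<lambda>p. loaded_list (fst p) (fst (snd p)) (snd (snd p)))"
    unfolding loaded_list_def by (intro computable_intros)
  from computable_compose3[OF this assms] show ?thesis .
qed

lemma computable_obsolete_list [computable_intros]:
  assumes "computable f" "computable g" "computable h"
  shows "computable (\<lambda>x. obsolete_list (f x) (g x) (h x))"
proof -
  have "computable (\<lambda>p. obsolete_list (fst p) (fst (snd p)) (snd (snd p)))"
    unfolding obsolete_list_def by (intro computable_intros)
  from computable_compose3[OF this assms] show ?thesis .
qed

lemma computable_active_list [computable_intros]:
  assumes "computable f" "computable g" shows "computable (\<lambda>x. active_list (f x) (g x))"
proof -
  have "computable (\<lambda>p. active_list (fst p) (snd p))"
    unfolding active_list_def by (intro computable_intros)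
  from computable_compose2[OF this assms] show ?thesis .
qed

lemma computable_successors [computable_intros]:
  assumes "computable f" "computable g" "computable h"
  shows "computable (\<lambda>x. successors (f x) (g x) (h x))"
proof -
  have "computable (\<lambda>p. successors (fst p) (fst (snd p)) (snd (snd p)))"
    unfolding successors_def by (intro computable_intros)
  from computable_compose3[OF this assms] show ?thesis .
qed

lemma computable_no_fair_path [computable_intros]:
  assumes "computable f" "computable g" "computable h"
  shows "computable (\<lambda>x. no_fair_path (f x) (g x) (h x))"
proof -
  have "computable (\<lambda>p. no_fair_path (fst p) (fst (snd p)) (snd (snd p)))"
    unfolding no_fair_path_def paths_def fair_path_def exis_bound_def by (intro computable_intros)
  from computable_compose3[OF this assms] show ?thesis .
qed

lemma computable_rules_ok [computable_intros]:
  assumes "computable f" shows "computable (\<lambda>x. rules_ok (f x))"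
  by (rule computable_comp[OF _ assms]) (unfold rules_ok_def, intro computable_intros)

lemma computable_database_ok [computable_intros]:
  assumes "computable f" shows "computable (\<lambda>x. database_ok (f x))"
  by (rule computable_comp[OF _ assms]) (unfold database_ok_def, intro computable_intros)

text \<open>With surjective codes every input of a recursive function is the code of some object, so
  nothing has to be known about its behaviour outside the codes.\<close>

lemma surj_enc_prod:
  assumes "surj (enc :: 'a::encodable \<Rightarrow> nat)" "surj (enc :: 'b::encodable \<Rightarrow> nat)"
  shows "surj (enc :: 'a \<times> 'b \<Rightarrow> nat)"
  unfolding surj_def
proof
  fix n
  obtain m k where n: "n = prod_encode (m, k)" by (metis prod_decode_inverse surj_pair)
  obtain a :: 'a and b :: 'b where "m = enc a" "k = enc b" using assms by (meson surjD)
  then have "n = enc (a, b)" by (simp add: n enc_prod_def)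
  then show "\<exists>p::'a \<times> 'b. n = enc p" by blast
qed

lemma surj_enc_list:
  assumes "surj (enc :: 'a::encodable \<Rightarrow> nat)"
  shows "surj (enc :: 'a list \<Rightarrow> nat)"
  unfolding surj_def
proof
  fix n
  have "enc (map (inv (enc :: 'a \<Rightarrow> nat)) (list_decode n)) = n"
    using assms by (simp add: enc_list_def comp_def surj_f_inv_f)
  then show "\<exists>xs::'a list. n = enc xs" by metis
qed

lemma surj_enc_trm: "surj (enc :: trm \<Rightarrow> nat)"
  unfolding surj_def
proof
  fix n :: nat
  have "n = 3 * (n div 3) \<or> n = 3 * (n div 3) + 1 \<or> n = 3 * (n div 3) + 2" by presburger
  then have "n = enc (Var (n div 3)) \<or> n = enc (Const (n div 3)) \<or> n = enc (Null (n div 3))"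
    by (simp only: enc_trm_def trm_code.simps)
  then show "\<exists>t::trm. n = enc t" by blast
qed

lemma surj_enc_nat: "surj (enc :: nat \<Rightarrow> nat)"
  by (simp add: surj_def enc_nat_def)

lemma surj_enc_atom: "surj (enc :: atom \<Rightarrow> nat)"
  unfolding surj_def
proof
  fix n
  obtain p :: "nat \<times> trm list" where "n = enc p"
    using surj_enc_prod[OF surj_enc_nat surj_enc_list[OF surj_enc_trm]] by (meson surjD)
  then have "n = enc (Atom (fst p) (snd p))" by (simp add: enc_atom_eq)
  then show "\<exists>a::atom. n = enc a" by blast
qed

lemma surj_enc_ex_rule: "surj (enc :: ex_rule \<Rightarrow> nat)"
  unfolding surj_def
proof
  fix n
  obtain p :: "atom list \<times> atom list" where "n = enc p"
    using surj_enc_prod[OF surj_enc_list surj_enc_list, OF surj_enc_atom surj_enc_atom] by (meson surjD)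
  then have "n = enc (Rule (fst p) (snd p))" by (simp add: enc_ex_rule_eq)
  then show "\<exists>R::ex_rule. n = enc R" by blast
qed

lemma atoms_code_enc: "atoms_code as = enc as"
  by (simp add: atoms_code_def enc_list_def enc_atom_def)

lemma rules_code_enc: "rules_code Rs = enc Rs"
  by (simp add: rules_code_def enc_list_def enc_ex_rule_def)

section \<open>From computable predicates to the arithmetical hierarchy\<close>

lemma recursively_enumerable_projection:
  fixes Q :: "nat \<times> 'a::encodable \<Rightarrow> bool"
  assumes "computable Q" "surj (enc :: 'a \<Rightarrow> nat)"
  shows "recursively_enumerable {enc x | x. \<exists>n. Q (n, x)}"
proof -
  \<comment> \<open>Truth is represented by 0 here, because \<open>Mu\<close> searches for a
    zero.\<close>
  have "computable (\<lambda>p. if Q p then 0 else 1 :: nat)" by (intro computable_intros assms(1))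
  then obtain g where g: "rec_fun 1 g" "\<And>p. g [enc p] = enc (if Q p then 0 else 1 :: nat)"
    unfolding computable_def by blast
  have "rec_fun 2 (\<lambda>xs. g [prod_encode (xs ! 0, xs ! 1)])"
    by (intro rec_fun_comp1 g(1) rec_fun_prod_encode rec_fun_nth) auto
  then obtain r where r: "\<And>xs. length xs = 2 \<Longrightarrow> rec_eval r xs (g [prod_encode (xs ! 0, xs ! 1)])"
    unfolding rec_fun_def by blast
  have eval: "rec_eval r [n, enc x] (if Q (n, x) then 0 else 1)" for n and x :: 'a
    using r[of "[n, enc x]"] g(2)[of "(n, x)"] by (simp add: enc_prod_def enc_nat_def)
  have iff: "(\<exists>y. rec_eval (Mu r) [enc x] y) \<longleftrightarrow> (\<exists>n. Q (n, x))" for x :: 'a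
  proof
    assume "\<exists>y. rec_eval (Mu r) [enc x] y"
    then obtain y where "rec_eval (Mu r) [enc x] y" by blast
    then have "rec_eval r [y, enc x] 0" by (cases rule: rec_eval.cases) auto
    then have "(if Q (y, x) then 0 else 1 :: nat) = 0" by (rule rec_eval_deterministic[OF eval])
    then have "Q (y, x)" by (simp split: if_splits)
    then show "\<exists>n. Q (n, x)" by blast
  next
    assume ex: "\<exists>n. Q (n, x)"
    \<comment> \<open>The least witness is taken since \<open>eval_Mu\<close> asks for nonzero
      values at all smaller arguments.\<close>
    let ?n = "LEAST n. Q (n, x)"
    have "Q (?n, x)" using ex by (rule LeastI_ex)
    then have "rec_eval r [?n, enc x] 0" using eval[of ?n x] by simp
    moreover have "rec_eval r [m, enc x] (Suc 0)" if "m < ?n" for m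
      using eval[of m x] not_less_Least[OF that] by simp
    ultimately have "rec_eval (Mu r) [enc x] ?n" by (intro eval_Mu) blast+
    then show "\<exists>y. rec_eval (Mu r) [enc x] y" by blast
  qed
  have "{enc x | x::'a. \<exists>n. Q (n, x)} = {m. \<exists>y. rec_eval (Mu r) [m] y}"
  proof (intro set_eqI)
    fix m
    obtain x :: 'a where "m = enc x" using assms(2) by (meson surjD)
    then show "m \<in> {enc x | x::'a. \<exists>n. Q (n, x)} \<longleftrightarrow> m \<in> {m. \<exists>y. rec_eval (Mu r) [m] y}"
      by (simp add: iff)
  qed
  then show ?thesis unfolding recursively_enumerable_def by blast
qed

lemma in_Pi02_projection:
  fixes Q :: "'a::encodable \<times> 'b::encodable \<times> nat \<Rightarrow> bool"
  assumes "computable Q" "surj (enc :: 'a \<Rightarrow> nat)" "surj (enc :: 'b \<Rightarrow> nat)"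
  shows "in_Pi02 {enc x | x. \<forall>y. \<exists>n. Q (x, y, n)}"
proof -
  obtain g where g: "rec_fun 1 g" "\<And>p. g [enc p] = enc (Q p)"
    using assms(1) unfolding computable_def by blast
  define P where "P xs \<longleftrightarrow> g [prod_encode (xs ! 0, prod_encode (xs ! 1, xs ! 2))] = 1" for xs
  have P: "P [enc x, enc y, n] \<longleftrightarrow> Q (x, y, n)" for x :: 'a and y :: 'b and n
    using g(2)[of "(x, y, n)"] by (simp add: P_def enc_prod_def enc_nat_def enc_bool_def)
  have fun3: "rec_fun 3 (\<lambda>xs. g [prod_encode (xs ! 0, prod_encode (xs ! 1, xs ! 2))])"
    by (intro rec_fun_comp1 g(1) rec_fun_prod_encode rec_fun_nth) auto
  \<comment> \<open>All \<open>a\<close> and \<open>b\<close> are codes, so \<open>g\<close> takes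
    only the values 0 and 1 on these triples and is itself the characteristic function that
    \<open>recursive_relation\<close> requires.\<close>
  have if_P: "g [prod_encode (a, prod_encode (b, c))] =
      (if g [prod_encode (a, prod_encode (b, c))] = 1 then 1 else 0)" for a b c
  proof -
    obtain x :: 'a and y :: 'b where "a = enc x" "b = enc y" using assms(2,3) by (meson surjD)
    then show ?thesis using g(2)[of "(x, y, c)"] by (simp add: enc_prod_def enc_nat_def enc_bool_def)
  qed
  have "recursive_relation 3 P"
    using fun3 unfolding recursive_relation_def rec_fun_def P_def if_P[symmetric] .
  moreover have "{enc x | x. \<forall>y. \<exists>n. Q (x, y, n)} = {a. \<forall>b. \<exists>c. P [a, b, c]}"
  proof (intro set_eqI)
    fix a
    obtain x :: 'a where x: "a = enc x" using assms(2) by (meson surjD)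
    have "(\<forall>b. \<exists>c. P [a, b, c]) \<longleftrightarrow> (\<forall>y. \<exists>n. Q (x, y, n))"
    proof
      assume "\<forall>b. \<exists>c. P [a, b, c]"
      then show "\<forall>y. \<exists>n. Q (x, y, n)" unfolding x P[symmetric] by blast
    next
      assume *: "\<forall>y. \<exists>n. Q (x, y, n)"
      show "\<forall>b. \<exists>c. P [a, b, c]"
      proof
        fix b
        obtain y :: 'b where y: "b = enc y" using assms(3) by (meson surjD)
        show "\<exists>c. P [a, b, c]" unfolding x y P using * by blast
      qed
    qed
    then show "a \<in> {enc x | x. \<forall>y. \<exists>n. Q (x, y, n)} \<longleftrightarrow> a \<in> {a. \<forall>b. \<exists>c. P [a, b, c]}"
      by (auto simp: x)
  qed
  ultimately show ?thesis unfolding in_Pi02_def by blast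
qed

theorem theorem6p3:
  shows "recursively_enumerable (kb_codes CT_rest_bf) \<and> in_Pi02 (rules_codes CT_rest_bf_rules)"
proof
  \<comment> \<open>The length \<open>n\<close> comes first in the tuple, since minimisation acts on
    the first argument.\<close>
  let ?Q = "\<lambda>p :: nat \<times> ex_rule list \<times> atom list. rules_ok (fst (snd p)) \<and> database_ok (snd (snd p)) \<and>
    no_fair_path (fst (snd p)) (snd (snd p)) (fst p)"
  have "recursively_enumerable {enc x | x. \<exists>n. ?Q (n, x)}"
    by (rule recursively_enumerable_projection, intro computable_intros)
      (intro surj_enc_prod surj_enc_list surj_enc_atom surj_enc_ex_rule)
  moreover have "{enc x | x. \<exists>n. ?Q (n, x)} = kb_codes CT_rest_bf"
    unfolding kb_codes_def CT_rest_bf_iff kb_code_def rules_code_enc atoms_code_enc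
    by (auto simp: enc_prod_def)
  ultimately show "recursively_enumerable (kb_codes CT_rest_bf)" by simp
next
  let ?Q = "\<lambda>p :: ex_rule list \<times> atom list \<times> nat. rules_ok (fst p) \<and>
    (database_ok (fst (snd p)) \<longrightarrow> no_fair_path (fst p) (fst (snd p)) (snd (snd p)))"
  have "in_Pi02 {enc x | x. \<forall>y. \<exists>n. ?Q (x, y, n)}"
    by (rule in_Pi02_projection, intro computable_intros)
      (intro surj_enc_list surj_enc_atom surj_enc_ex_rule)+
  then show "in_Pi02 (rules_codes CT_rest_bf_rules)"
    unfolding rules_codes_def CT_rest_bf_rules_iff rules_code_enc by simp
qed

end
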